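(* Let $c_1,\dots,c_k,n,h,\lambda$ be positive integers with $2\leq c_1\leq \cdots\leq c_k\leq n$ and $h\geq \frac n2+2$. Then $\lambda K_n^h$ can be decomposed into $k$ almost regular spanning cycles of lengths $c_1,\dots,c_k$ if and only if $\sum_{i=1}^k c_i=\lambda\binom{n}{h}$.
   Context: $\lambda K_n^h$ is the $\lambda$-fold complete $n$-vertex $h$-uniform hypergraph: its vertex set has $n$ elements and each $h$-subset of the vertex set occurs as an edge exactly $\lambda$ times (the copies being distinct edges). A hypergraph with vertex set $V$ and edge set $E$ is a cycle of length $t$ (a Berge cycle, $t\geq 2$) if there is an alternating sequence $v_1,e_1,v_2,e_2,\dots,v_t,e_t$ of distinct vertices $v_i\in V$ and distinct edges $e_i$ with $E=\{e_1,\dots,e_t\}$ and $\{v_i,v_{i+1}\}\subseteq e_i$ for $1\leq i\leq t$, where $v_{t+1}:=v_1$. (The vertices $v_1,\dots,v_t$ need not be all of $V$.) A cycle is spanning if every vertex of the whole hypergraph belongs to some edge of the cycle. The degree of a vertex is the number of edges containing it; a hypergraph is almost regular if there is an integer $d$ such that every vertex has degree $d$ or $d+1$ (for a spanning cycle this refers to all $n$ vertices, with degrees counted in the cycle). A decomposition of a hypergraph is a partition of its edge set; here the $i$-th part is the edge set of the cycle of length $c_i$. *)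

theory Defs
  imports Complex_Main "HOL-Library.Disjoint_Sets"
begin

text \<open>Edges are abstract objects with a set of end vertices, so that distinct edges may be
  parallel (have the same end vertices).\<close>

record ('v, 'e) hypergraph =
  verts :: "'v set"
  edges :: "'e set"
  ends :: "'e \<Rightarrow> 'v set"

text \<open>The \<open>m\<close> parallel copies of an \<open>h\<close>-subset \<open>S\<close> of \<open>V\<close> are the pairs
  \<open>(S, j)\<close> with \<open>j < m\<close>.\<close>

definition complete_hypergraph ::
    "nat \<Rightarrow> nat \<Rightarrow> 'v set \<Rightarrow> ('v, 'v set \<times> nat) hypergraph" where
  "complete_hypergraph m h V =
     \<lparr> verts = V, edges = {S. S \<subseteq> V \<and> card S = h} \<times> {..<m}, ends = fst \<rparr>"

definition degree :: "('v, 'e) hypergraph \<Rightarrow> 'v \<Rightarrow> nat" where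
  "degree H v = card {e \<in> edges H. v \<in> ends H e}"

definition almost_regular :: "('v, 'e) hypergraph \<Rightarrow> bool" where
  "almost_regular H \<longleftrightarrow> (\<exists>d. \<forall>v \<in> verts H. degree H v = d \<or> degree H v = d + 1)"

text \<open>Berge cycles, with positions numbered from \<open>0\<close> to \<open>t - 1\<close> and read modulo \<open>t\<close>.
  The vertices of the cyclic sequence need not exhaust \<^term>\<open>verts H\<close>.\<close>

definition is_cycle :: "('v, 'e) hypergraph \<Rightarrow> nat \<Rightarrow> bool" where
  "is_cycle H t \<longleftrightarrow> t \<ge> 2 \<and>
     (\<exists>v e. inj_on v {..<t} \<and> v ` {..<t} \<subseteq> verts H \<and>
            inj_on e {..<t} \<and> edges H = e ` {..<t} \<and>
            (\<forall>i<t. {v i, v (Suc i mod t)} \<subseteq> ends H (e i)))"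

definition spanning :: "('v, 'e) hypergraph \<Rightarrow> bool" where
  "spanning H \<longleftrightarrow> (\<forall>v \<in> verts H. \<exists>e \<in> edges H. v \<in> ends H e)"

definition decomposition :: "('v, 'e) hypergraph \<Rightarrow> 'i set \<Rightarrow> ('i \<Rightarrow> 'e set) \<Rightarrow> bool" where
  "decomposition H I P \<longleftrightarrow>
     (\<Union>i\<in>I. P i) = edges H \<and> disjoint_family_on P I \<and> (\<forall>i\<in>I. P i \<noteq> {})"

text \<open>Each part keeps the full vertex set of \<open>H\<close>, so being spanning and being almost regular
  refer to all vertices of \<open>H\<close>, with degrees counted inside the part.\<close>

definition decomposes_into_ar_spanning_cycles ::
    "('v, 'e) hypergraph \<Rightarrow> nat \<Rightarrow> (nat \<Rightarrow> nat) \<Rightarrow> bool" where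
  "decomposes_into_ar_spanning_cycles H k c \<longleftrightarrow>
     (\<exists>P. decomposition H {1..k} P \<and>
          (\<forall>i\<in>{1..k}. is_cycle (H\<lparr>edges := P i\<rparr>) (c i) \<and>
                       spanning (H\<lparr>edges := P i\<rparr>) \<and>
                       almost_regular (H\<lparr>edges := P i\<rparr>)))"

end

(*
  By Baranyai's argument the edges can be distributed almost regularly with prescribed class sizes:
  the vertices are revealed one at a time, keeping only the traces of the edges on the revealed
  vertices, and the traces to be extended by the next vertex are chosen by rounding a fractional
  solution to an integral one.

  It remains to see that every almost regular class of t edges, 2 <= t <= n, is a Berge cycle, i.e.
  that the bipartite incidence graph has a cycle through all t edges. By a closure argument there is
  a path through all of them; since 2h >= n + 4 and all degrees are at least (t - 2) / 2, a crossing
  argument shows that no end of such a path has a neighbour off the path, while a rotation would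
  produce an end that does have one.
*)

theory Submission
  imports Defs
begin

section \<open>Rounding matrices\<close>

text \<open>The fractional choice is the symmetric one: an edge with trace \<open>S\<close> still
  lacks \<open>h - card S\<close> of the unrevealed vertices, so each of these receives an equal
  share of it. Since all \<open>h\<close>-subsets occur equally often, the shares add up to integers
  over the parts. Within one part they add up to the average degree still to come, which lies
  between \<open>q i\<close> and \<open>q i + 1\<close>; so a rounding that respects floors and
  ceilings of entries and of row sums gives the new vertex a permitted degree. For the cycles, the
  obstacle is that \<open>n\<close> may be much larger than \<open>t\<close>, so that neighbours of
  an end of a path may lie off it, where a Dirac type count sees nothing. The constant 4 settles
  this: without a cycle, an end with such a neighbour forces both ends to have at most
  \<open>(t + 2) / 2\<close> neighbours on the path and disjoint neighbourhoods among the
  \<open>n - t + 1\<close> vertices off it, in all \<open>n + 3\<close> instead of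
  \<open>n + 4\<close>. Otherwise all neighbours of an end are on the path, and
  \<open>(n + 4) / 2 + (t - 2) / 2 > t\<close> gives the place to rotate.\<close>

lemma homogeneous_system_nontrivial_solution:
  fixes a :: "'e \<Rightarrow> 'f \<Rightarrow> real"
  assumes "finite Q" "finite F" "card Q < card F"
  shows "\<exists>z. (\<exists>f\<in>F. z f \<noteq> 0) \<and> (\<forall>e\<in>Q. (\<Sum>f\<in>F. a e f * z f) = 0)"
  using assms
proof (induction Q arbitrary: F a rule: finite_induct)
  case empty
  then have "F \<noteq> {}" by auto
  then show ?case by (intro exI[of _ "\<lambda>_. 1"]) auto
next
  case (insert e0 Q)
  show ?case
  proof (cases "\<exists>f0\<in>F. a e0 f0 \<noteq> 0")
    case False
    have "card Q < card F" using insert by simp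
    from insert.IH[OF \<open>finite F\<close> this, of a] obtain z where
      "\<exists>f\<in>F. z f \<noteq> 0" "\<forall>e\<in>Q. (\<Sum>f\<in>F. a e f * z f) = 0" by blast
    then show ?thesis using False by (intro exI[of _ z]) auto
  next
    case True
    then obtain f0 where f0: "f0 \<in> F" "a e0 f0 \<noteq> 0" by blast
    define F' where "F' = F - {f0}"
    \<comment> \<open>Gaussian elimination: the pivot \<open>a e0 f0\<close> solves equation
      \<open>e0\<close> for the unknown \<open>f0\<close>, and \<open>a'\<close> is the system left
      after substitution.\<close>
    define a' where "a' e f = a e f - a e f0 / a e0 f0 * a e0 f" for e f
    have F': "finite F'" "card Q < card F'" "f0 \<notin> F'" and FF: "F = insert f0 F'"
      using insert f0 by (auto simp: F'_def)
    from insert.IH[OF F'(1,2), of a'] obtain z' where z':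
      "\<exists>f\<in>F'. z' f \<noteq> 0" "\<forall>e\<in>Q. (\<Sum>f\<in>F'. a' e f * z' f) = 0" by blast
    define s where "s = (\<Sum>f\<in>F'. a e0 f * z' f)"
    define z where "z f = (if f = f0 then - s / a e0 f0 else z' f)" for f
    have split: "(\<Sum>f\<in>F. a e f * z f) = - a e f0 * s / a e0 f0 + (\<Sum>f\<in>F'. a e f * z' f)" for e
    proof -
      have "(\<Sum>f\<in>F'. a e f * z f) = (\<Sum>f\<in>F'. a e f * z' f)"
        using F'(3) by (intro sum.cong) (auto simp: z_def)
      then show ?thesis using F' by (simp add: FF z_def)
    qed
    have "(\<Sum>f\<in>F. a e f * z f) = 0" if "e \<in> Q" for e
    proof -
      have "0 = (\<Sum>f\<in>F'. a' e f * z' f)" using z' that by simp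
      also have "\<dots> = (\<Sum>f\<in>F'. a e f * z' f) - a e f0 / a e0 f0 * s"
        by (simp add: a'_def s_def sum_distrib_left sum_subtractf algebra_simps)
      finally show ?thesis by (simp add: split)
    qed
    moreover have "(\<Sum>f\<in>F. a e0 f * z f) = 0"
      using f0 by (simp add: split s_def[symmetric])
    moreover have "\<exists>f\<in>F. z f \<noteq> 0" using z'(1) F'(3) by (auto simp: z_def FF)
    ultimately show ?thesis by (intro exI[of _ z]) auto
  qed
qed

text \<open>Every nonempty fibre of \<open>g\<close> has at least two elements. With
  \<open>g\<close> a projection of a support, this bounds the numbers of rows and columns
  met.\<close>

lemma double_card_image_le:
  assumes "finite F" and "\<And>f. f \<in> F \<Longrightarrow> \<exists>f'\<in>F. f' \<noteq> f \<and> g f' = g f"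
  shows "2 * card (g ` F) \<le> card F"
proof -
  have "2 \<le> card {f\<in>F. g f = y}" if "y \<in> g ` F" for y
  proof -
    from that obtain f where f: "f \<in> F" "y = g f" by blast
    with assms(2) obtain f' where f': "f' \<in> F" "f' \<noteq> f" "g f' = g f" by metis
    have "card {f, f'} \<le> card {f\<in>F. g f = y}"
      using f f' assms(1) by (intro card_mono) auto
    then show ?thesis using f' by simp
  qed
  then have "(\<Sum>y\<in>g ` F. 2) \<le> (\<Sum>y\<in>g ` F. card {f\<in>F. g f = y})"
    by (intro sum_mono)
  also have "\<dots> = card F"
    using sum.image_gen[OF assms(1), of "\<lambda>_. 1::nat" g] by simp
  finally show ?thesis by simp
qed

text \<open>A support meeting each of its rows and columns at least twice has at least as many entries
  as it has rows and columns together, and one of the column equations is redundant.\<close>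

lemma zero_sum_matrix_supported_on:
  assumes "finite I" "finite J" "F \<subseteq> I \<times> J" "F \<noteq> {}"
    and row: "\<And>i j. (i, j) \<in> F \<Longrightarrow> \<exists>j'. j' \<noteq> j \<and> (i, j') \<in> F"
    and col: "\<And>i j. (i, j) \<in> F \<Longrightarrow> \<exists>i'. i' \<noteq> i \<and> (i', j) \<in> F"
  shows "\<exists>z :: 'i \<Rightarrow> 'j \<Rightarrow> real.
    (\<forall>i j. (i, j) \<notin> F \<longrightarrow> z i j = 0) \<and> (\<exists>(i, j)\<in>F. z i j \<noteq> 0) \<and>
    (\<forall>i\<in>I. (\<Sum>j\<in>J. z i j) = 0) \<and> (\<forall>j\<in>J. (\<Sum>i\<in>I. z i j) = 0)"
proof -
  have finF: "finite F" using assms finite_subset by blast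
  obtain j0 where j0: "j0 \<in> snd ` F" using assms(4) by blast
  define Q where "Q = Inl ` fst ` F \<union> Inr ` (snd ` F - {j0})"
  define a :: "'i + 'j \<Rightarrow> 'i \<times> 'j \<Rightarrow> real" where
    "a e f = (case e of Inl i \<Rightarrow> of_bool (fst f = i) | Inr j \<Rightarrow> of_bool (snd f = j))" for e f
  have "2 * card (fst ` F) \<le> card F"
  proof (rule double_card_image_le[OF finF])
    fix f assume "f \<in> F"
    then obtain j' where "j' \<noteq> snd f" "(fst f, j') \<in> F" using row[of "fst f" "snd f"] by auto
    then show "\<exists>f'\<in>F. f' \<noteq> f \<and> fst f' = fst f"
      by (intro bexI[of _ "(fst f, j')"]) (auto simp: prod_eq_iff)
  qed
  moreover have "2 * card (snd ` F) \<le> card F"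
  proof (rule double_card_image_le[OF finF])
    fix f assume "f \<in> F"
    then obtain i' where "i' \<noteq> fst f" "(i', snd f) \<in> F" using col[of "fst f" "snd f"] by auto
    then show "\<exists>f'\<in>F. f' \<noteq> f \<and> snd f' = snd f"
      by (intro bexI[of _ "(i', snd f)"]) (auto simp: prod_eq_iff)
  qed
  moreover have "card (Inr ` (snd ` F - {j0}) :: ('i + 'j) set) < card (snd ` F)"
    using j0 finF by (subst card_image) (auto intro!: psubset_card_mono simp del: card_Diff_insert card_Diff_singleton)
  moreover have "card (Inl ` fst ` F :: ('i + 'j) set) = card (fst ` F)"
    by (rule card_image) auto
  ultimately have "card Q < card F"
    unfolding Q_def using card_Un_le[of "Inl ` fst ` F" "Inr ` (snd ` F - {j0})"] by linarith
  moreover have "finite Q" using finF by (simp add: Q_def)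
  ultimately obtain w where w: "\<exists>f\<in>F. w f \<noteq> 0" "\<forall>e\<in>Q. (\<Sum>f\<in>F. a e f * w f) = 0"
    using homogeneous_system_nontrivial_solution[OF _ finF, of Q a] by blast
  define z where "z i j = (if (i, j) \<in> F then w (i, j) else 0)" for i j
  have to_matrix: "(\<Sum>f\<in>F. g f * w f) = (\<Sum>i\<in>I. \<Sum>j\<in>J. g (i, j) * z i j)" for g
  proof -
    have "(\<Sum>f\<in>F. g f * w f) = (\<Sum>f\<in>F. g f * z (fst f) (snd f))"
      by (intro sum.cong) (auto simp: z_def)
    also have "\<dots> = (\<Sum>f\<in>I \<times> J. g f * z (fst f) (snd f))"
      using assms by (intro sum.mono_neutral_left) (auto simp: z_def)
    finally show ?thesis by (simp add: sum.cartesian_product case_prod_beta)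
  qed
  have rows: "(\<Sum>j\<in>J. z i j) = 0" if "i \<in> I" for i
  proof (cases "i \<in> fst ` F")
    case True
    then have "0 = (\<Sum>f\<in>F. a (Inl i) f * w f)" using w(2) by (simp add: Q_def)
    also have "\<dots> = (\<Sum>i'\<in>I. if i' = i then \<Sum>j\<in>J. z i' j else 0)"
      unfolding to_matrix a_def by (intro sum.cong) auto
    finally show ?thesis using that assms(1) by simp
  next
    case False
    then show ?thesis by (intro sum.neutral) (force simp: z_def)
  qed
  have cols': "(\<Sum>i\<in>I. z i j) = 0" if "j \<in> J" "j \<noteq> j0" for j
  proof (cases "j \<in> snd ` F")
    case True
    then have "0 = (\<Sum>f\<in>F. a (Inr j) f * w f)" using w(2) that by (simp add: Q_def)
    also have "\<dots> = (\<Sum>j'\<in>J. if j' = j then \<Sum>i\<in>I. z i j' else 0)"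
      unfolding to_matrix a_def by (subst sum.swap) (intro sum.cong, auto)
    finally show ?thesis using that assms(2) by simp
  next
    case False
    then show ?thesis by (intro sum.neutral) (force simp: z_def)
  qed
  have "j0 \<in> J" using j0 assms(3) by auto
  \<comment> \<open>The equation of column \<open>j0\<close>, omitted from \<open>Q\<close>: the
    entries sum to 0 over all rows, and every other column contributes 0.\<close>
  have "0 = (\<Sum>j\<in>J. \<Sum>i\<in>I. z i j)" using rows by (subst sum.swap) simp
  also have "\<dots> = (\<Sum>i\<in>I. z i j0)"
    using \<open>j0 \<in> J\<close> assms(2) cols' by (simp add: sum.remove[of J j0])
  finally have "(\<Sum>i\<in>I. z i j) = 0" if "j \<in> J" for j
    using cols' that by (cases "j = j0") auto
  moreover have "\<exists>(i, j)\<in>F. z i j \<noteq> 0" using w(1) by (auto simp: z_def)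
  moreover have "z i j = 0" if "(i, j) \<notin> F" for i j using that by (simp add: z_def)
  ultimately show ?thesis using rows by (intro exI[of _ z]) blast
qed

text \<open>Otherwise \<open>f a\<close> would be a difference of integers. Applied to rows and
  columns, it shows that fractional entries never occur alone in a line.\<close>

lemma other_noninteger_summand:
  fixes f :: "'a \<Rightarrow> real"
  assumes "finite A" "sum f A \<in> \<int>" "a \<in> A" "f a \<notin> \<int>"
  shows "\<exists>b\<in>A. b \<noteq> a \<and> f b \<notin> \<int>"
proof (rule ccontr)
  assume "\<not> ?thesis"
  then have "sum f (A - {a}) \<in> \<int>" by (intro Ints_sum) auto
  moreover have "f a = sum f A - sum f (A - {a})"
    using assms by (simp add: sum.remove)
  ultimately show False using assms by (metis Ints_diff)
qed

text \<open>Moving \<open>x\<close> along a zero-sum matrix supported on its fractional entries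
  keeps all line sums. Stopping when the first entry becomes integral keeps every entry between its
  floor and ceiling and leaves fewer fractional entries.\<close>

lemma matrix_rounding:
  fixes x :: "'i \<Rightarrow> 'j \<Rightarrow> real"
  assumes "finite I" "finite J"
    and "\<And>i. i \<in> I \<Longrightarrow> (\<Sum>j\<in>J. x i j) \<in> \<int>" and "\<And>j. j \<in> J \<Longrightarrow> (\<Sum>i\<in>I. x i j) \<in> \<int>"
  shows "\<exists>y :: 'i \<Rightarrow> 'j \<Rightarrow> int.
    (\<forall>i\<in>I. \<forall>j\<in>J. \<lfloor>x i j\<rfloor> \<le> y i j \<and> y i j \<le> \<lceil>x i j\<rceil>) \<and>
    (\<forall>i\<in>I. (\<Sum>j\<in>J. real_of_int (y i j)) = (\<Sum>j\<in>J. x i j)) \<and>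
    (\<forall>j\<in>J. (\<Sum>i\<in>I. real_of_int (y i j)) = (\<Sum>i\<in>I. x i j))"
  using assms(3,4)
proof (induction "card {(i, j) \<in> I \<times> J. x i j \<notin> \<int>}" arbitrary: x rule: less_induct)
  case less
  define F where "F = {(i, j) \<in> I \<times> J. x i j \<notin> \<int>}"
  have finF: "finite F" unfolding F_def
    by (rule finite_subset[of _ "I \<times> J"]) (use assms in auto)
  show ?case
  proof (cases "F = {}")
    case True
    then have "x i j \<in> \<int>" if "i \<in> I" "j \<in> J" for i j using that by (auto simp: F_def)
    then have "real_of_int \<lfloor>x i j\<rfloor> = x i j" if "i \<in> I" "j \<in> J" for i j
      using that by (metis Ints_cases floor_of_int)
    then show ?thesis
      by (intro exI[of _ "\<lambda>i j. \<lfloor>x i j\<rfloor>"] conjI ballI sum.cong)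
        (simp_all add: floor_le_ceiling)
  next
    case False
    have sub: "F \<subseteq> I \<times> J" by (auto simp: F_def)
    have row: "\<exists>j'. j' \<noteq> j \<and> (i, j') \<in> F" if "(i, j) \<in> F" for i j
      using other_noninteger_summand[OF assms(2), of "x i" j] less.prems(1) that
      by (auto simp: F_def)
    have col: "\<exists>i'. i' \<noteq> i \<and> (i', j) \<in> F" if "(i, j) \<in> F" for i j
      using other_noninteger_summand[OF assms(1), of "\<lambda>i. x i j" i] less.prems(2) that
      by (auto simp: F_def)
    have "\<exists>z :: 'i \<Rightarrow> 'j \<Rightarrow> real.
        (\<forall>i j. (i, j) \<notin> F \<longrightarrow> z i j = 0) \<and> (\<exists>(i, j)\<in>F. z i j \<noteq> 0) \<and>
        (\<forall>i\<in>I. (\<Sum>j\<in>J. z i j) = 0) \<and> (\<forall>j\<in>J. (\<Sum>i\<in>I. z i j) = 0)"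
      by (intro zero_sum_matrix_supported_on assms(1,2) sub False row col)
    then obtain z :: "'i \<Rightarrow> 'j \<Rightarrow> real" where z: "\<forall>i j. (i, j) \<notin> F \<longrightarrow> z i j = 0"
      "\<exists>(i, j)\<in>F. z i j \<noteq> 0" "\<forall>i\<in>I. (\<Sum>j\<in>J. z i j) = 0" "\<forall>j\<in>J. (\<Sum>i\<in>I. z i j) = 0"
      by blast
    note zF = z(1)[rule_format] and nz = z(2) and zr = z(3)[rule_format] and zc = z(4)[rule_format]
    \<comment> \<open>The room an entry has in the direction in which \<open>z\<close> moves
      it.\<close>
    define gap where "gap i j = (if z i j > 0 then \<lceil>x i j\<rceil> - x i j else x i j - \<lfloor>x i j\<rfloor>)" for i j
    define G where "G = {(i, j) \<in> F. z i j \<noteq> 0}"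
    define r where "r = (\<lambda>(i, j). gap i j / \<bar>z i j\<bar>)"
    have G: "finite G" "G \<noteq> {}"
      using nz finF by (auto simp: G_def intro: finite_subset[of _ F])
    \<comment> \<open>The longest step that no entry overshoots; the entry attaining the minimum
      lands on an integer.\<close>
    define \<epsilon> where "\<epsilon> = Min (r ` G)"
    have "\<epsilon> \<in> r ` G" unfolding \<epsilon>_def using G by (intro Min_in) auto
    then obtain i0 j0 where ij0: "(i0, j0) \<in> G" "\<epsilon> = gap i0 j0 / \<bar>z i0 j0\<bar>"
      by (auto simp: r_def)
    have gap0: "gap i j \<ge> 0" for i j
      unfolding gap_def by (auto simp: le_of_int_ceiling)
    then have \<epsilon>0: "\<epsilon> \<ge> 0" using ij0 by simp
    have \<epsilon>_le: "\<epsilon> * \<bar>z i j\<bar> \<le> gap i j" for i j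
    proof (cases "(i, j) \<in> G")
      case True
      then have "\<epsilon> \<le> gap i j / \<bar>z i j\<bar>" unfolding \<epsilon>_def
        using G by (intro Min_le) (auto simp: r_def image_iff intro!: bexI[of _ "(i, j)"])
      then show ?thesis using True by (simp add: G_def field_simps)
    next
      case False
      then have "z i j = 0" using zF by (auto simp: G_def)
      then show ?thesis using gap0 by simp
    qed
    define x' where "x' i j = x i j + \<epsilon> * z i j" for i j
    have lo: "\<lfloor>x i j\<rfloor> \<le> x' i j" and hi: "x' i j \<le> \<lceil>x i j\<rceil>" for i j
    proof -
      have "\<lfloor>x i j\<rfloor> \<le> x' i j \<and> x' i j \<le> \<lceil>x i j\<rceil>"
      proof (cases "z i j > 0")
        case True
        then have "0 \<le> \<epsilon> * z i j" "\<epsilon> * z i j \<le> \<lceil>x i j\<rceil> - x i j"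
          using \<epsilon>_le[of i j] \<epsilon>0 by (auto simp: gap_def)
        then show ?thesis using of_int_floor_le[of "x i j"] unfolding x'_def by linarith
      next
        case False
        then have "\<epsilon> * z i j \<le> 0" "- (\<epsilon> * z i j) \<le> x i j - \<lfloor>x i j\<rfloor>"
          using \<epsilon>_le[of i j] \<epsilon>0 by (auto simp: gap_def mult_le_0_iff)
        then show ?thesis using le_of_int_ceiling[of "x i j"] unfolding x'_def by linarith
      qed
      then show "\<lfloor>x i j\<rfloor> \<le> x' i j" "x' i j \<le> \<lceil>x i j\<rceil>" by auto
    qed
    have "x' i0 j0 = (if z i0 j0 > 0 then \<lceil>x i0 j0\<rceil> else \<lfloor>x i0 j0\<rfloor>)"
      using ij0 by (auto simp: x'_def gap_def G_def)
    then have int0: "x' i0 j0 \<in> \<int>" by (simp split: if_splits)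
    have "{(i, j) \<in> I \<times> J. x' i j \<notin> \<int>} \<subset> F"
    proof
      show "{(i, j) \<in> I \<times> J. x' i j \<notin> \<int>} \<subseteq> F"
      proof clarify
        fix i j assume "i \<in> I" "j \<in> J" "x' i j \<notin> \<int>"
        then show "(i, j) \<in> F" using zF[of i j] by (auto simp: x'_def F_def)
      qed
      show "{(i, j) \<in> I \<times> J. x' i j \<notin> \<int>} \<noteq> F" using int0 ij0 by (auto simp: G_def)
    qed
    then have "card {(i, j) \<in> I \<times> J. x' i j \<notin> \<int>} < card F"
      using finF by (rule psubset_card_mono[rotated])
    moreover have sumr: "(\<Sum>j\<in>J. x' i j) = (\<Sum>j\<in>J. x i j)" if "i \<in> I" for i
      using zr[OF that] by (simp add: x'_def sum.distrib flip: sum_distrib_left)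
    moreover have sumc: "(\<Sum>i\<in>I. x' i j) = (\<Sum>i\<in>I. x i j)" if "j \<in> J" for j
      using zc[OF that] by (simp add: x'_def sum.distrib flip: sum_distrib_left)
    ultimately obtain y where y:
      "\<forall>i\<in>I. \<forall>j\<in>J. \<lfloor>x' i j\<rfloor> \<le> y i j \<and> y i j \<le> \<lceil>x' i j\<rceil>"
      "\<forall>i\<in>I. (\<Sum>j\<in>J. real_of_int (y i j)) = (\<Sum>j\<in>J. x' i j)"
      "\<forall>j\<in>J. (\<Sum>i\<in>I. real_of_int (y i j)) = (\<Sum>i\<in>I. x' i j)"
      using less.hyps[of x'] less.prems unfolding F_def by auto
    \<comment> \<open>Rounding intervals only shrink, so bounds relative to \<open>x'\<close> are
      bounds relative to \<open>x\<close>.\<close>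
    have mono: "\<lfloor>x i j\<rfloor> \<le> \<lfloor>x' i j\<rfloor>" "\<lceil>x' i j\<rceil> \<le> \<lceil>x i j\<rceil>" for i j
      using lo[of i j] hi[of i j] by (auto simp: le_floor_iff ceiling_le_iff)
    have "\<lfloor>x i j\<rfloor> \<le> y i j" "y i j \<le> \<lceil>x i j\<rceil>" if "i \<in> I" "j \<in> J" for i j
      using y(1) that mono[of i j] by (blast intro: order_trans)+
    then show ?thesis using y(2,3) sumr sumc by (intro exI[of _ y]) simp
  qed
qed

text \<open>Row sums need not be integral here: a slack column makes them vanish.\<close>

lemma matrix_rounding_integral_columns:
  fixes x :: "'i \<Rightarrow> 'j \<Rightarrow> real"
  assumes "finite I" "finite J" and col: "\<And>j. j \<in> J \<Longrightarrow> (\<Sum>i\<in>I. x i j) \<in> \<int>"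
  obtains y :: "'i \<Rightarrow> 'j \<Rightarrow> int" where
    "\<And>i j. i \<in> I \<Longrightarrow> j \<in> J \<Longrightarrow> \<lfloor>x i j\<rfloor> \<le> y i j"
    "\<And>i j. i \<in> I \<Longrightarrow> j \<in> J \<Longrightarrow> y i j \<le> \<lceil>x i j\<rceil>"
    "\<And>i. i \<in> I \<Longrightarrow> \<lfloor>\<Sum>j\<in>J. x i j\<rfloor> \<le> (\<Sum>j\<in>J. y i j)"
    "\<And>i. i \<in> I \<Longrightarrow> (\<Sum>j\<in>J. y i j) \<le> \<lceil>\<Sum>j\<in>J. x i j\<rceil>"
    "\<And>j. j \<in> J \<Longrightarrow> (\<Sum>i\<in>I. real_of_int (y i j)) = (\<Sum>i\<in>I. x i j)"
proof -
  define x' where "x' i o' = (case o' of None \<Rightarrow> - (\<Sum>j\<in>J. x i j) | Some j \<Rightarrow> x i j)" for i o'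
  let ?J = "insert None (Some ` J)"
  have split: "(\<Sum>j\<in>?J. g j) = g None + (\<Sum>j\<in>J. g (Some j))" for g :: "'j option \<Rightarrow> real"
    using assms(2) by (simp add: sum.reindex)
  have rows: "(\<Sum>j\<in>?J. x' i j) = 0" for i
    unfolding split by (simp add: x'_def)
  have "(\<Sum>i\<in>I. x' i j) \<in> \<int>" if "j \<in> ?J" for j
  proof (cases j)
    case None
    \<comment> \<open>The slack column sums to minus the total of the given columns, each of which
      is integral.\<close>
    have "(\<Sum>i\<in>I. x' i j) = - (\<Sum>j\<in>J. \<Sum>i\<in>I. x i j)"
      unfolding None by (subst sum.swap) (simp add: x'_def sum_negf)
    then show ?thesis using col by (auto intro: Ints_minus Ints_sum)
  qed (use that col in \<open>auto simp: x'_def\<close>)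
  then have "\<exists>y :: 'i \<Rightarrow> 'j option \<Rightarrow> int.
    (\<forall>i\<in>I. \<forall>j\<in>?J. \<lfloor>x' i j\<rfloor> \<le> y i j \<and> y i j \<le> \<lceil>x' i j\<rceil>) \<and>
    (\<forall>i\<in>I. (\<Sum>j\<in>?J. real_of_int (y i j)) = (\<Sum>j\<in>?J. x' i j)) \<and>
    (\<forall>j\<in>?J. (\<Sum>i\<in>I. real_of_int (y i j)) = (\<Sum>i\<in>I. x' i j))"
    using assms(1,2) by (intro matrix_rounding) (simp_all only: rows Ints_0 finite_insert finite_imageI)
  then obtain y where y:
    "\<forall>i\<in>I. \<forall>j\<in>?J. \<lfloor>x' i j\<rfloor> \<le> y i j \<and> y i j \<le> \<lceil>x' i j\<rceil>"
    "\<forall>i\<in>I. (\<Sum>j\<in>?J. real_of_int (y i j)) = 0"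
    "\<forall>j\<in>?J. (\<Sum>i\<in>I. real_of_int (y i j)) = (\<Sum>i\<in>I. x' i j)"
    unfolding rows by blast
  have rowy: "(\<Sum>j\<in>J. y i (Some j)) = - y i None" if "i \<in> I" for i
  proof -
    have "real_of_int (y i None + (\<Sum>j\<in>J. y i (Some j))) = 0"
      using y(2) that unfolding split by simp
    then show ?thesis by linarith
  qed
  \<comment> \<open>The slack entry carries the rounding of the row sum; negation exchanges its
    floor and ceiling.\<close>
  have slack: "\<lfloor>- (\<Sum>j\<in>J. x i j)\<rfloor> \<le> y i None" "y i None \<le> \<lceil>- (\<Sum>j\<in>J. x i j)\<rceil>" if "i \<in> I" for i
    using y(1) that by (auto simp: x'_def)
  show ?thesis
  proof (rule that[of "\<lambda>i j. y i (Some j)"])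
    show "\<lfloor>x i j\<rfloor> \<le> y i (Some j)" "y i (Some j) \<le> \<lceil>x i j\<rceil>" if "i \<in> I" "j \<in> J" for i j
      using y(1) that by (auto simp: x'_def)
    show "\<lfloor>\<Sum>j\<in>J. x i j\<rfloor> \<le> (\<Sum>j\<in>J. y i (Some j))" "(\<Sum>j\<in>J. y i (Some j)) \<le> \<lceil>\<Sum>j\<in>J. x i j\<rceil>"
      if "i \<in> I" for i
      using slack[OF that] rowy[OF that] by (simp_all add: ceiling_def)
    show "(\<Sum>i\<in>I. real_of_int (y i (Some j))) = (\<Sum>i\<in>I. x i j)" if "j \<in> J" for j
      using y(3) that by (auto simp: x'_def)
  qed
qed

section \<open>Baranyai's theorem\<close>

lemma sum_Pow_insert:
  assumes "finite U" "u \<notin> U"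
  shows "(\<Sum>S\<in>Pow (insert u U). g S) = (\<Sum>S\<in>Pow U. g S + g (insert u S))"
proof -
  have "inj_on (insert u) (Pow U)"
    using assms(2) by (intro inj_onI) (metis PowD insert_ident subsetD)
  moreover have "Pow U \<inter> insert u ` Pow U = {}" using assms(2) by auto
  ultimately show ?thesis using assms(1)
    by (simp add: Pow_insert sum.union_disjoint sum.reindex sum.distrib)
qed

text \<open>The number of \<open>h\<close>-subsets of a set with \<open>r\<close> elements outside \<open>U\<close> that meet \<open>U\<close> in a given
  subset of size \<open>s\<close>.\<close>

definition extensions :: "nat \<Rightarrow> nat \<Rightarrow> nat \<Rightarrow> nat" where
  "extensions h r s = (if s \<le> h then r choose (h - s) else 0)"

text \<open>Count pairs of an extension and an outside vertex in it: each extension has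
  \<open>h - s\<close> such vertices, and fixing the vertex first leaves a trace of size
  \<open>s + 1\<close> with \<open>r\<close> vertices outside. This identity makes the fractional
  column sums integral. For \<open>s > h\<close> the integer difference is negative, but both counts
  are 0.\<close>

lemma extensions_absorb:
  "int (extensions h (Suc r) s) * (int h - int s) = int (Suc r) * int (extensions h r (Suc s))"
proof (cases "s < h")
  case True
  then obtain d where d: "h = Suc (s + d)" using less_imp_Suc_add by blast
  have "int (Suc d * (Suc r choose Suc d)) = int (Suc r * (r choose d))"
    by (simp only: Suc_times_binomial)
  moreover have "int h - int s = int (Suc d)" "extensions h (Suc r) s = Suc r choose Suc d"
    "extensions h r (Suc s) = r choose d"
    using d by (simp_all add: extensions_def Suc_diff_le del: binomial_Suc_Suc)
  ultimately show ?thesis by (simp only: of_nat_mult mult.commute)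
qed (auto simp: extensions_def)

text \<open>Pascal's rule: either the extension avoids the newly revealed vertex or its trace grows
  by it.\<close>

lemma extensions_Suc: "extensions h (Suc r) s = extensions h r s + extensions h r (Suc s)"
proof (cases "s < h")
  case True
  then obtain d where "h = Suc (s + d)" using less_imp_Suc_add by blast
  then show ?thesis by (simp add: extensions_def Suc_diff_le)
qed (auto simp: extensions_def)

lemma extensions_eq_0: "s > h \<or> h > s + r \<Longrightarrow> extensions h r s = 0"
  by (auto simp: extensions_def binomial_eq_0)

text \<open>\<open>M i S\<close> is the number of edges in the \<open>i\<close>-th part whose trace on \<open>U\<close> is \<open>S\<close>. In the last
  condition, the sum is the total degree in part \<open>i\<close> of the vertices outside \<open>U\<close>.\<close>

lemma baranyai_traces:
  fixes V :: "'v set" and c q :: "'i \<Rightarrow> nat" and m h :: nat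
  assumes "finite I" "finite V" and "U \<subseteq> V"
    and total: "(\<Sum>i\<in>I. c i) = m * (card V choose h)"
    and q: "\<And>i. i \<in> I \<Longrightarrow> q i * card V \<le> c i * h \<and> c i * h \<le> (q i + 1) * card V"
  shows "\<exists>M :: 'i \<Rightarrow> 'v set \<Rightarrow> int.
    (\<forall>i\<in>I. \<forall>S\<in>Pow U. 0 \<le> M i S) \<and>
    (\<forall>S\<in>Pow U. (\<Sum>i\<in>I. M i S) = int m * int (extensions h (card V - card U) (card S))) \<and>
    (\<forall>i\<in>I. (\<Sum>S\<in>Pow U. M i S) = int (c i)) \<and>
    (\<forall>i\<in>I. \<forall>v\<in>U. (\<Sum>S\<in>Pow U. of_bool (v \<in> S) * M i S) \<in> {int (q i), int (q i) + 1}) \<and>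
    (\<forall>i\<in>I. (\<Sum>S\<in>Pow U. M i S * (int h - int (card S)))
      \<in> {int (q i) * int (card V - card U)..(int (q i) + 1) * int (card V - card U)})"
  using finite_subset[OF assms(3,2)] assms(3)
proof (induction U rule: finite_induct)
  case empty
  have "int (c i) * int h \<in> {int (q i) * int (card V)..(int (q i) + 1) * int (card V)}"
    if "i \<in> I" for i
  proof -
    have "int (q i * card V) \<le> int (c i * h)" "int (c i * h) \<le> int ((q i + 1) * card V)"
      using q[OF that] by (simp_all only: of_nat_le_iff)
    then show ?thesis by (simp add: algebra_simps)
  qed
  moreover have "(\<Sum>i\<in>I. int (c i)) = int m * int (card V choose h)"
    using total by (metis of_nat_mult of_nat_sum)
  ultimately show ?case
    by (intro exI[of _ "\<lambda>i S. int (c i)"]) (simp add: extensions_def)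
next
  case (insert u U)
  then have "card U < card V" using assms(2) by (intro psubset_card_mono) auto
  then obtain r where r: "card V - card U = Suc r" "card V - card (insert u U) = r"
    using insert.hyps by (metis Suc_diff_Suc card_insert_disjoint)
  have "U \<subseteq> V" using insert.prems by simp
  from insert.IH[OF this, unfolded r] obtain M :: "'i \<Rightarrow> 'v set \<Rightarrow> int" where
    M: "\<forall>i\<in>I. \<forall>S\<in>Pow U. 0 \<le> M i S"
      "\<forall>S\<in>Pow U. (\<Sum>i\<in>I. M i S) = int m * int (extensions h (Suc r) (card S))"
      "\<forall>i\<in>I. (\<Sum>S\<in>Pow U. M i S) = int (c i)"
      "\<forall>i\<in>I. \<forall>v\<in>U. (\<Sum>S\<in>Pow U. of_bool (v \<in> S) * M i S) \<in> {int (q i), int (q i) + 1}"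
      "\<forall>i\<in>I. (\<Sum>S\<in>Pow U. M i S * (int h - int (card S)))
        \<in> {int (q i) * int (Suc r)..(int (q i) + 1) * int (Suc r)}"
    by blast
  note M0 = M(1)[rule_format, OF _ PowI] and M1 = M(2)[rule_format, OF PowI]
    and M2 = M(3)[rule_format] and M3 = M(4)[rule_format] and M4 = M(5)[rule_format]
  \<comment> \<open>Sets that are no trace of an \<open>h\<close>-set carry no edges. On the others
    \<open>h - card S\<close> lies between 0 and \<open>Suc r\<close>, which makes
    \<open>x i S\<close> a genuine fraction of \<open>M i S\<close>.\<close>
  have zero: "M i S = 0" if "i \<in> I" "S \<subseteq> U" "card S > h \<or> h > card S + Suc r" for i S
  proof -
    have "(\<Sum>i\<in>I. M i S) = 0" using M1 that(2) extensions_eq_0[OF that(3)] by simp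
    then have "\<forall>i\<in>I. M i S = 0"
      using M0 that(2) by (subst (asm) sum_nonneg_eq_0_iff[OF assms(1)]) auto
    then show ?thesis using that(1) by blast
  qed
  define x :: "'i \<Rightarrow> 'v set \<Rightarrow> real" where
    "x i S = of_int (M i S * (int h - int (card S))) / of_nat (Suc r)" for i S
  have colsum: "(\<Sum>i\<in>I. x i S) = of_int (int m * int (extensions h r (Suc (card S))))"
    if "S \<subseteq> U" for S
  proof -
    have "(\<Sum>i\<in>I. M i S * (int h - int (card S))) =
        int (Suc r) * (int m * int (extensions h r (Suc (card S))))"
      unfolding sum_distrib_right[symmetric] M1[OF that] mult.assoc extensions_absorb
      by (rule mult.left_commute)
    moreover have "(\<Sum>i\<in>I. x i S) = of_int (\<Sum>i\<in>I. M i S * (int h - int (card S))) / of_nat (Suc r)"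
      unfolding x_def of_int_sum sum_divide_distrib ..
    ultimately show ?thesis by (simp del: of_nat_Suc)
  qed
  have x0: "0 \<le> x i S" and xM: "x i S \<le> of_int (M i S)" if "i \<in> I" "S \<subseteq> U" for i S
  proof -
    have "0 \<le> x i S \<and> x i S \<le> of_int (M i S)"
    proof (cases "M i S = 0")
      case False
      then have "card S \<le> h" "h \<le> card S + Suc r" using zero[OF that] by (meson not_le)+
      then have "0 \<le> M i S * (int h - int (card S))"
        "M i S * (int h - int (card S)) \<le> M i S * int (Suc r)"
        using M0[OF that] by (auto intro: mult_left_mono)
      then have "0 \<le> real_of_int (M i S * (int h - int (card S)))"
        "real_of_int (M i S * (int h - int (card S))) \<le> of_int (M i S * int (Suc r))"
        by (simp_all only: of_int_0_le_iff of_int_le_iff)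
      then show ?thesis by (simp add: x_def divide_le_eq del: of_nat_Suc)
    qed (simp add: x_def)
    then show "0 \<le> x i S" "x i S \<le> of_int (M i S)" by auto
  qed
  obtain y where y:
    "\<And>i S. i \<in> I \<Longrightarrow> S \<in> Pow U \<Longrightarrow> \<lfloor>x i S\<rfloor> \<le> y i S"
    "\<And>i S. i \<in> I \<Longrightarrow> S \<in> Pow U \<Longrightarrow> y i S \<le> \<lceil>x i S\<rceil>"
    "\<And>i. i \<in> I \<Longrightarrow> \<lfloor>\<Sum>S\<in>Pow U. x i S\<rfloor> \<le> (\<Sum>S\<in>Pow U. y i S)"
    "\<And>i. i \<in> I \<Longrightarrow> (\<Sum>S\<in>Pow U. y i S) \<le> \<lceil>\<Sum>S\<in>Pow U. x i S\<rceil>"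
    "\<And>S. S \<in> Pow U \<Longrightarrow> (\<Sum>i\<in>I. real_of_int (y i S)) = (\<Sum>i\<in>I. x i S)"
  proof (rule matrix_rounding_integral_columns[OF assms(1), of "Pow U" x])
    show "(\<Sum>i\<in>I. x i S) \<in> \<int>" if "S \<in> Pow U" for S using colsum that by simp
  qed (use insert.hyps in auto)
  have y0: "0 \<le> y i S" and yM: "y i S \<le> M i S" if "i \<in> I" "S \<subseteq> U" for i S
  proof -
    have "0 \<le> \<lfloor>x i S\<rfloor>" "\<lceil>x i S\<rceil> \<le> M i S"
      using x0[OF that] xM[OF that] by (simp_all add: ceiling_le_iff)
    moreover have "\<lfloor>x i S\<rfloor> \<le> y i S" "y i S \<le> \<lceil>x i S\<rceil>" using y(1,2) that by auto
    ultimately show "0 \<le> y i S" "y i S \<le> M i S" by (blast intro: order_trans)+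
  qed
  have ysum: "(\<Sum>i\<in>I. y i S) = int m * int (extensions h r (Suc (card S)))" if "S \<subseteq> U" for S
  proof -
    have "real_of_int (\<Sum>i\<in>I. y i S) = of_int (int m * int (extensions h r (Suc (card S))))"
      using y(5)[of S] that colsum[OF that] by simp
    then show ?thesis by (simp only: of_int_eq_iff)
  qed
  \<comment> \<open>\<open>R i\<close> is the total degree still to be placed and \<open>d i\<close>
    the part of it placed at \<open>u\<close>. The rounded row sum is \<open>R i / Suc r\<close>, an
    average between \<open>q i\<close> and \<open>q i + 1\<close>.\<close>
  define R where "R i = (\<Sum>S\<in>Pow U. M i S * (int h - int (card S)))" for i
  define d where "d i = (\<Sum>S\<in>Pow U. y i S)" for i
  have dR: "d i \<in> {int (q i), int (q i) + 1} \<and>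
      R i - d i \<in> {int (q i) * int r..(int (q i) + 1) * int r}" if "i \<in> I" for i
  proof -
    have xR: "(\<Sum>S\<in>Pow U. x i S) = of_int (R i) / of_int (int (Suc r))"
      unfolding x_def R_def of_int_sum sum_divide_distrib by simp
    have RR: "int (q i) * int (Suc r) \<le> R i" "R i \<le> (int (q i) + 1) * int (Suc r)"
      using M4[OF that] by (auto simp: R_def)
    have lo: "\<lfloor>real_of_int (R i) / of_int (int (Suc r))\<rfloor> \<le> d i"
      using y(3)[OF that] unfolding xR d_def .
    have hi: "d i \<le> \<lceil>real_of_int (R i) / of_int (int (Suc r))\<rceil>"
      using y(4)[OF that] unfolding xR d_def .
    have above: "a \<le> d i" if "a * int (Suc r) \<le> R i" for a
    proof -
      have "real_of_int (a * int (Suc r)) \<le> of_int (R i)" using that by (simp only: of_int_le_iff)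
      then have "real_of_int a \<le> real_of_int (R i) / of_int (int (Suc r))"
        by (simp add: le_divide_eq)
      then show ?thesis using lo by (meson le_floor_iff order_trans)
    qed
    have below: "d i \<le> a" if "R i \<le> a * int (Suc r)" for a
    proof -
      have "real_of_int (R i) \<le> of_int (a * int (Suc r))" using that by (simp only: of_int_le_iff)
      then have "real_of_int (R i) / of_int (int (Suc r)) \<le> real_of_int a"
        by (simp add: divide_le_eq)
      then show ?thesis using hi by (meson ceiling_le_iff order_trans)
    qed
    have "int (q i) \<le> d i" "d i \<le> int (q i) + 1" using above below RR by auto
    then consider "d i = int (q i)" | "d i = int (q i) + 1" by linarith
    then show ?thesis
    proof cases
      case 1
      \<comment> \<open>At equality \<open>d i\<close> would have been \<open>q i + 1\<close>. Being
        strict over the integers, the bound has a unit to spare, which turns it into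
        \<open>R i - q i \<le> (q i + 1) * r\<close>. The other case is symmetric.\<close>
      then have "R i < (int (q i) + 1) * int (Suc r)" using above[of "int (q i) + 1"] by linarith
      then show ?thesis using 1 RR by (simp add: algebra_simps)
    next
      case 2
      then have "R i > int (q i) * int (Suc r)" using below[of "int (q i)"] by linarith
      then show ?thesis using 2 RR by (simp add: algebra_simps)
    qed
  qed
  \<comment> \<open>Of the \<open>M i S\<close> edges with trace \<open>S\<close>, exactly
    \<open>y i S\<close> are extended by \<open>u\<close>.\<close>
  define M' where "M' i S = (if u \<in> S then y i (S - {u}) else M i S - y i S)" for i S
  have M'1: "M' i S = M i S - y i S" "M' i (insert u S) = y i S" if "S \<subseteq> U" for i S
  proof -
    have "u \<notin> S" using that insert.hyps by blast
    then show "M' i S = M i S - y i S" "M' i (insert u S) = y i S" by (simp_all add: M'_def)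
  qed
  have cardi: "card (insert u S) = Suc (card S)" if "S \<subseteq> U" for S
    using that insert.hyps by (meson card_insert_disjoint finite_subset subsetD)
  note sPI = sum_Pow_insert[OF insert.hyps]
  have cases_Pow: "P S" if "S \<in> Pow (insert u U)" "\<And>T. T \<subseteq> U \<Longrightarrow> P T" "\<And>T. T \<subseteq> U \<Longrightarrow> P (insert u T)" for P S
    using that by (auto simp: Pow_insert)
  show ?case unfolding r
  proof (intro exI[of _ M'] conjI ballI)
    fix i S assume "i \<in> I" "S \<in> Pow (insert u U)"
    then show "0 \<le> M' i S"
      by (intro cases_Pow[of S "\<lambda>S. 0 \<le> M' i S"]) (auto simp: M'1 y0 yM)
  next
    fix S assume "S \<in> Pow (insert u U)"
    then show "(\<Sum>i\<in>I. M' i S) = int m * int (extensions h r (card S))"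
    proof (rule cases_Pow)
      fix T assume T: "T \<subseteq> U"
      show "(\<Sum>i\<in>I. M' i T) = int m * int (extensions h r (card T))"
        by (simp add: M'1[OF T] sum_subtractf M1[OF T] ysum[OF T] extensions_Suc algebra_simps)
      show "(\<Sum>i\<in>I. M' i (insert u T)) = int m * int (extensions h r (card (insert u T)))"
        by (simp add: M'1[OF T] ysum[OF T] cardi[OF T])
    qed
  next
    fix i assume i: "i \<in> I"
    have "(\<Sum>S\<in>Pow (insert u U). M' i S) = (\<Sum>S\<in>Pow U. M i S)"
      unfolding sPI by (intro sum.cong) (auto simp: M'1)
    then show "(\<Sum>S\<in>Pow (insert u U). M' i S) = int (c i)" using M2[OF i] by simp
  next
    fix i v assume i: "i \<in> I" and v: "v \<in> insert u U"
    show "(\<Sum>S\<in>Pow (insert u U). of_bool (v \<in> S) * M' i S) \<in> {int (q i), int (q i) + 1}"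
    proof (cases "v = u")
      case True
      have "(\<Sum>S\<in>Pow (insert u U). of_bool (v \<in> S) * M' i S) = d i"
        unfolding sPI d_def using insert.hyps True by (intro sum.cong) (auto simp: M'1)
      then show ?thesis using dR[OF i] by simp
    next
      case False
      have "(\<Sum>S\<in>Pow (insert u U). of_bool (v \<in> S) * M' i S) = (\<Sum>S\<in>Pow U. of_bool (v \<in> S) * M i S)"
        unfolding sPI using False by (intro sum.cong) (auto simp: M'1)
      then show ?thesis using M3[OF i, of v] v False by simp
    qed
  next
    fix i assume i: "i \<in> I"
    have "(\<Sum>S\<in>Pow (insert u U). M' i S * (int h - int (card S))) = R i - d i"
      unfolding sPI R_def d_def sum_subtractf[symmetric]
      by (intro sum.cong) (auto simp: M'1 cardi algebra_simps)
    then show "(\<Sum>S\<in>Pow (insert u U). M' i S * (int h - int (card S)))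
        \<in> {int (q i) * int r..(int (q i) + 1) * int r}" using dR[OF i] by simp
  qed
qed

text \<open>Consecutive intervals do it. The purpose is to turn multiplicities into actual sets of
  copy numbers.\<close>

lemma partition_lessThan_sum:
  fixes a :: "'i \<Rightarrow> nat"
  assumes "finite I"
  shows "\<exists>p. (\<Union>i\<in>I. p i) = {..<sum a I} \<and> disjoint_family_on p I \<and> (\<forall>i\<in>I. card (p i) = a i)"
  using assms
proof (induction I rule: finite_induct)
  case (insert j I)
  then obtain p where p: "(\<Union>i\<in>I. p i) = {..<sum a I}" "disjoint_family_on p I"
    "\<forall>i\<in>I. card (p i) = a i" by blast
  define p' where "p' = p(j := {sum a I..<sum a I + a j})"
  have p': "p' i = p i" if "i \<in> I" for i using that insert.hyps by (auto simp: p'_def)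
  have "(\<Union>i\<in>insert j I. p' i) = p' j \<union> (\<Union>i\<in>I. p i)"
    using p' by auto
  then have "(\<Union>i\<in>insert j I. p' i) = {sum a I..<sum a I + a j} \<union> {..<sum a I}"
    unfolding p(1) by (simp add: p'_def)
  then have "(\<Union>i\<in>insert j I. p' i) = {..<sum a (insert j I)}"
    using insert.hyps by (simp add: Un_commute ivl_disj_un_one(2) add.commute)
  moreover have "p i \<subseteq> {..<sum a I}" if "i \<in> I" for i using p(1) that by blast
  then have "disjoint_family_on p' (insert j I)"
    unfolding disjoint_family_on_insert[OF insert.hyps(2)]
    using p(2) p' by (fastforce simp: disjoint_family_on_def p'_def)
  moreover have "\<forall>i\<in>insert j I. card (p' i) = a i" using p(3) p' by (simp add: p'_def)
  ultimately show ?case by blast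
qed (auto simp: disjoint_family_on_def)

text \<open>With all vertices revealed a trace is the edge itself: \<open>extensions h 0 s\<close>
  is 1 for \<open>s = h\<close> and 0 otherwise, so the counts describe a distribution of the
  \<open>m\<close> copies of each \<open>h\<close>-subset. The bounds on \<open>q i\<close> say that
  the average degree in part \<open>i\<close> lies between \<open>q i\<close> and
  \<open>q i + 1\<close>.\<close>

theorem baranyai:
  fixes V :: "'v set" and c q :: "'i \<Rightarrow> nat" and m h :: nat
  assumes "finite I" "finite V"
    and total: "(\<Sum>i\<in>I. c i) = m * (card V choose h)"
    and q: "\<And>i. i \<in> I \<Longrightarrow> q i * card V \<le> c i * h \<and> c i * h \<le> (q i + 1) * card V"
  shows "\<exists>P :: 'i \<Rightarrow> ('v set \<times> nat) set.
    (\<Union>i\<in>I. P i) = {S. S \<subseteq> V \<and> card S = h} \<times> {..<m} \<and> disjoint_family_on P I \<and>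
    (\<forall>i\<in>I. card (P i) = c i \<and> (\<forall>v\<in>V. card {e \<in> P i. v \<in> fst e} \<in> {q i, q i + 1}))"
proof -
  let ?K = "{S. S \<subseteq> V \<and> card S = h}"
  have K: "finite ?K" "?K \<subseteq> Pow V" using assms(2) by auto
  from baranyai_traces[OF assms(1,2) order_refl total q] obtain M :: "'i \<Rightarrow> 'v set \<Rightarrow> int" where
    M: "\<forall>i\<in>I. \<forall>S\<in>Pow V. 0 \<le> M i S"
      "\<forall>S\<in>Pow V. (\<Sum>i\<in>I. M i S) = int m * int (extensions h 0 (card S))"
      "\<forall>i\<in>I. (\<Sum>S\<in>Pow V. M i S) = int (c i)"
      "\<forall>i\<in>I. \<forall>v\<in>V. (\<Sum>S\<in>Pow V. of_bool (v \<in> S) * M i S) \<in> {int (q i), int (q i) + 1}"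
    unfolding diff_self_eq_0 by blast
  define N where "N i S = nat (M i S)" for i S
  have N: "int (N i S) = M i S" if "i \<in> I" "S \<subseteq> V" for i S
    using M(1) that by (simp add: N_def)
  have NK: "(\<Sum>i\<in>I. N i S) = m" if "S \<in> ?K" for S
  proof -
    have "int (\<Sum>i\<in>I. N i S) = (\<Sum>i\<in>I. M i S)" using N that by simp
    also have "\<dots> = int m" using M(2) that by (simp add: extensions_def)
    finally show ?thesis by (simp only: of_nat_eq_iff)
  qed
  have N0: "N i S = 0" if "i \<in> I" "S \<in> Pow V - ?K" for i S
  proof -
    have "int (\<Sum>i\<in>I. N i S) = (\<Sum>i\<in>I. M i S)" using N that by simp
    also have "\<dots> = 0" using M(2) that by (auto simp: extensions_def)
    finally have "(\<Sum>i\<in>I. N i S) = 0" by (simp only: of_nat_eq_0_iff)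
    then show ?thesis using assms(1) that(1) by simp
  qed
  have "\<exists>p. \<forall>S. (\<Union>i\<in>I. p S i) = {..<\<Sum>i\<in>I. N i S} \<and> disjoint_family_on (p S) I \<and>
      (\<forall>i\<in>I. card (p S i) = N i S)"
    by (intro choice allI partition_lessThan_sum assms(1))
  then obtain p where p': "\<forall>S. (\<Union>i\<in>I. p S i) = {..<\<Sum>i\<in>I. N i S} \<and>
      disjoint_family_on (p S) I \<and> (\<forall>i\<in>I. card (p S i) = N i S)" ..
  have p: "(\<Union>i\<in>I. p S i) = {..<\<Sum>i\<in>I. N i S}" "disjoint_family_on (p S) I"
    "\<And>i. i \<in> I \<Longrightarrow> card (p S i) = N i S" for S
    using p'[rule_format, of S] by auto
  have finp: "finite (p S i)" if "i \<in> I" for S i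
    using p(1)[of S] that by (metis UN_upper finite_lessThan finite_subset)
  \<comment> \<open>\<open>p S i\<close> holds the numbers of those copies of \<open>S\<close> that
    go to part \<open>i\<close>.\<close>
  define P where "P i = Sigma ?K (\<lambda>S. p S i)" for i
  have "(\<Union>i\<in>I. P i) = Sigma ?K (\<lambda>S. \<Union>i\<in>I. p S i)" by (auto simp: P_def)
  also have "\<dots> = ?K \<times> {..<m}" using NK by (auto simp: p(1))
  finally have "(\<Union>i\<in>I. P i) = ?K \<times> {..<m}" .
  moreover have "disjoint_family_on P I"
    using p(2) unfolding disjoint_family_on_def P_def by blast
  moreover have "card (P i) = c i" if i: "i \<in> I" for i
  proof -
    have "int (card (P i)) = int (\<Sum>S\<in>?K. N i S)"
      unfolding P_def using K(1) finp[OF i] p(3)[OF i] by (subst card_SigmaI) auto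
    also have "(\<Sum>S\<in>?K. N i S) = (\<Sum>S\<in>Pow V. N i S)"
      using N0[OF i] assms(2) K(2) by (intro sum.mono_neutral_left) auto
    also have "int (\<Sum>S\<in>Pow V. N i S) = (\<Sum>S\<in>Pow V. M i S)" using N i by simp
    finally show ?thesis using M(3) i by simp
  qed
  moreover have "card {e \<in> P i. v \<in> fst e} \<in> {q i, q i + 1}" if i: "i \<in> I" and v: "v \<in> V" for i v
  proof -
    have "{e \<in> P i. v \<in> fst e} = Sigma {S\<in>?K. v \<in> S} (\<lambda>S. p S i)" by (auto simp: P_def)
    moreover have "finite {S\<in>?K. v \<in> S}" by (rule finite_subset[OF _ K(1)]) auto
    ultimately have "card {e \<in> P i. v \<in> fst e} = (\<Sum>S\<in>{S\<in>?K. v \<in> S}. N i S)"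
      using finp[OF i] p(3)[OF i] by (simp only: card_SigmaI ball_simps simp_thms)
    also have "\<dots> = (\<Sum>S\<in>?K. of_bool (v \<in> S) * N i S)"
      using K(1) by (intro sum.mono_neutral_cong_left) auto
    also have "\<dots> = (\<Sum>S\<in>Pow V. of_bool (v \<in> S) * N i S)"
      using N0[OF i] assms(2) K(2) by (intro sum.mono_neutral_left) auto
    finally have "int (card {e \<in> P i. v \<in> fst e}) = (\<Sum>S\<in>Pow V. int (of_bool (v \<in> S) * N i S))"
      by simp
    also have "\<dots> = (\<Sum>S\<in>Pow V. of_bool (v \<in> S) * M i S)"
      using N[OF i] by (intro sum.cong) auto
    finally have "int (card {e \<in> P i. v \<in> fst e}) \<in> {int (q i), int (q i) + 1}"
      using M(4) i v by simp
    then show ?thesis by auto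
  qed
  ultimately show ?thesis by (intro exI[of _ P]) simp
qed

section \<open>Cycles covering one side of a bipartite graph\<close>

text \<open>The cyclic order is \<open>a 0, b 0, a 1, b 1, ...\<close>, so \<open>b i\<close> comes
  between \<open>a i\<close> and its successor. In the application \<open>A\<close> consists of the
  edges and \<open>B\<close> of the vertices of a hypergraph.\<close>

definition covering_cycle :: "'a set \<Rightarrow> 'b set \<Rightarrow> ('a \<Rightarrow> 'b \<Rightarrow> bool) \<Rightarrow> (nat \<Rightarrow> 'a) \<Rightarrow> (nat \<Rightarrow> 'b) \<Rightarrow> bool"
  where "covering_cycle A B R a b \<longleftrightarrow>
    bij_betw a {..<card A} A \<and> inj_on b {..<card A} \<and> b ` {..<card A} \<subseteq> B \<and>
    (\<forall>i<card A. R (a i) (b i) \<and> R (a (Suc i mod card A)) (b i))"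

text \<open>Both ends lie in \<open>A\<close>, so the path uses one vertex of \<open>B\<close> fewer
  than a cycle.\<close>

definition covering_path :: "'a set \<Rightarrow> 'b set \<Rightarrow> ('a \<Rightarrow> 'b \<Rightarrow> bool) \<Rightarrow> (nat \<Rightarrow> 'a) \<Rightarrow> (nat \<Rightarrow> 'b) \<Rightarrow> bool"
  where "covering_path A B R a b \<longleftrightarrow>
    bij_betw a {..<card A} A \<and> inj_on b {..<card A - 1} \<and> b ` {..<card A - 1} \<subseteq> B \<and>
    (\<forall>i<card A - 1. R (a i) (b i) \<and> R (a (Suc i)) (b i))"

section \<open>Reversing, rotating and closing up paths\<close>

lemma bij_betw_lessThanI:
  fixes f :: "nat \<Rightarrow> nat"
  assumes "inj_on f {..<t}" "\<And>i. i < t \<Longrightarrow> f i < t"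
  shows "bij_betw f {..<t} {..<t}"
proof -
  have "f ` {..<t} \<subseteq> {..<t}" using assms(2) by blast
  from endo_inj_surj[OF finite_lessThan this assms(1)] show ?thesis
    using assms(1) by (simp add: bij_betw_def)
qed

lemma bij_betw_add_mod: "bij_betw (\<lambda>j. (s + j) mod t) {..<t} {..<t::nat}"
proof (rule bij_betw_lessThanI)
  show "inj_on (\<lambda>j. (s + j) mod t) {..<t}"
  proof (rule inj_onI)
    fix i j assume ij: "i \<in> {..<t}" "j \<in> {..<t}" "(s + i) mod t = (s + j) mod t"
    have eq: "i = j" if "(s + j) mod t = (s + i) mod t" "i \<le> j" "j < t" for i j
    proof -
      have "t dvd (s + j) - (s + i)" using that by (simp only: mod_eq_dvd_iff_nat add_le_mono)
      then have "t dvd j - i" by simp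
      then show ?thesis using that by (metis diff_is_0_eq dvd_imp_le leD le_antisym less_imp_diff_less not_gr_zero)
    qed
    show "i = j" using eq[of i j] eq[of j i] ij by (cases "i \<le> j") auto
  qed
qed auto

lemma covering_path_reverse:
  assumes "covering_path A B R a b"
  shows "covering_path A B R (\<lambda>i. a (card A - 1 - i)) (\<lambda>i. b (card A - 2 - i))"
proof -
  let ?t = "card A"
  have p: "bij_betw a {..<?t} A" "inj_on b {..<?t - 1}" "b ` {..<?t - 1} \<subseteq> B"
    "\<And>i. i < ?t - 1 \<Longrightarrow> R (a i) (b i) \<and> R (a (Suc i)) (b i)"
    using assms by (auto simp: covering_path_def)
  have "bij_betw (\<lambda>i. ?t - 1 - i) {..<?t} {..<?t}"
    by (rule bij_betw_lessThanI) (auto intro!: inj_onI)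
  from bij_betw_trans[OF this p(1)] have "bij_betw (\<lambda>i. a (?t - 1 - i)) {..<?t} A"
    by (simp add: o_def)
  moreover have bb: "bij_betw (\<lambda>i. ?t - 2 - i) {..<?t - 1} {..<?t - 1}"
    by (rule bij_betw_lessThanI) (auto intro!: inj_onI)
  have "inj_on (\<lambda>i. b (?t - 2 - i)) {..<?t - 1}"
    using comp_inj_on[of "\<lambda>i. ?t - 2 - i" "{..<?t - 1}" b] bb p(2)
    by (simp add: bij_betw_def o_def)
  moreover have "(\<lambda>i. b (?t - 2 - i)) ` {..<?t - 1} \<subseteq> B" using p(3) by auto
  moreover have "R (a (?t - 1 - i)) (b (?t - 2 - i)) \<and> R (a (?t - 1 - Suc i)) (b (?t - 2 - i))"
    if "i < ?t - 1" for i
  proof -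
    have "?t - 2 - i < ?t - 1" "Suc (?t - 2 - i) = ?t - 1 - i" "?t - 1 - Suc i = ?t - 2 - i"
      using that by auto
    then show ?thesis using p(4)[of "?t - 2 - i"] by metis
  qed
  ultimately show ?thesis unfolding covering_path_def by blast
qed

text \<open>Used to rewrite facts about a reversed path: a vertex of \<open>B\<close> off the path
  is off its reversal.\<close>

lemma covering_path_reverse_image:
  "(\<lambda>i. b (t - 2 - i)) ` {..<t - 1} = b ` {..<t - 1 :: nat}"
proof -
  have "bij_betw (\<lambda>i. t - 2 - i) {..<t - 1} {..<t - 1}"
    by (rule bij_betw_lessThanI) (auto intro!: inj_onI)
  then have "b ` (\<lambda>i. t - 2 - i) ` {..<t - 1} = b ` {..<t - 1}" by (simp add: bij_betw_def)
  then show ?thesis by (simp add: image_image)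
qed

text \<open>A Posa rotation: the adjacency of \<open>a i\<close> and \<open>b i\<close> is traded
  for that of \<open>a 0\<close> and \<open>b i\<close>, which reverses the initial segment and
  gives \<open>a i, b (i - 1), ..., b 0, a 0, b i, a (i + 1), ...\<close>. The same vertices of
  \<open>B\<close> remain on the path.\<close>

lemma covering_path_rotate:
  assumes "covering_path A B R a b" "i < card A - 1" "R (a 0) (b i)"
  obtains a' b' where "covering_path A B R a' b'" "a' 0 = a i"
    "b' ` {..<card A - 1} = b ` {..<card A - 1}"
proof -
  let ?t = "card A"
  have p: "bij_betw a {..<?t} A" "inj_on b {..<?t - 1}" "b ` {..<?t - 1} \<subseteq> B"
    "\<And>i. i < ?t - 1 \<Longrightarrow> R (a i) (b i) \<and> R (a (Suc i)) (b i)"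
    using assms by (auto simp: covering_path_def)
  define f where "f j = (if j \<le> i then i - j else j)" for j
  define g where "g j = (if j < i then i - 1 - j else j)" for j
  have f: "bij_betw f {..<?t} {..<?t}"
    using assms(2) by (intro bij_betw_lessThanI) (auto simp: f_def inj_on_def split: if_splits)
  have g: "bij_betw g {..<?t - 1} {..<?t - 1}"
    using assms(2) by (intro bij_betw_lessThanI) (auto simp: g_def inj_on_def split: if_splits)
  have img: "(b \<circ> g) ` {..<?t - 1} = b ` {..<?t - 1}"
    using g by (simp add: bij_betw_def flip: image_image)
  have "R ((a \<circ> f) j) ((b \<circ> g) j) \<and> R ((a \<circ> f) (Suc j)) ((b \<circ> g) j)" if "j < ?t - 1" for j
  proof -
    consider "j < i" | "j = i" | "i < j" by linarith
    then show ?thesis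
    proof cases
      case 1
      then have "f j = Suc (i - 1 - j)" "f (Suc j) = i - 1 - j" "g j = i - 1 - j"
        by (auto simp: f_def g_def)
      then show ?thesis using p(4)[of "i - 1 - j"] assms(2) by simp
    next
      case 2
      then show ?thesis using p(4)[of i] assms by (simp add: f_def g_def)
    next
      case 3
      then show ?thesis using p(4)[of j] that by (simp add: f_def g_def)
    qed
  qed
  then have "covering_path A B R (a \<circ> f) (b \<circ> g)"
    unfolding covering_path_def img
    using bij_betw_trans[OF f p(1)] comp_inj_on[of g "{..<?t - 1}" b] g p(2,3)
    by (auto simp: bij_betw_def)
  then show ?thesis using that[of "a \<circ> f" "b \<circ> g"] img by (simp add: f_def)
qed

text \<open>The cycle is
  \<open>a\<^sub>i\<^sub>+\<^sub>1 b\<^sub>i\<^sub>+\<^sub>1 \<dots> a\<^sub>t\<^sub>-\<^sub>1 v a\<^sub>i b\<^sub>i\<^sub>-\<^sub>1 \<dots> b\<^sub>0 a\<^sub>0 b\<^sub>i\<close>; for \<open>i = t - 1\<close> the vertex \<open>v\<close> plays the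
  role of \<open>b\<^sub>i\<close>.\<close>

lemma covering_path_crossing:
  assumes "covering_path A B R a b" "card A \<ge> 1" "v \<in> B - b ` {..<card A - 1}"
    and "R (a (card A - 1)) v" and "i < card A" "R (a i) v"
    and "R (a 0) ((b(card A - 1 := v)) i)"
  obtains a' b' where "covering_cycle A B R a' b'"
proof -
  let ?t = "card A" and ?b = "b(card A - 1 := v)"
  have p: "bij_betw a {..<?t} A" "inj_on b {..<?t - 1}" "b ` {..<?t - 1} \<subseteq> B"
    "\<And>i. i < ?t - 1 \<Longrightarrow> R (a i) (b i) \<and> R (a (Suc i)) (b i)"
    using assms(1) by (auto simp: covering_path_def)
  have t: "{..<?t} = insert (?t - 1) {..<?t - 1}" using assms(2) by auto
  have b: "inj_on ?b {..<?t}" "?b ` {..<?t} \<subseteq> B"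
    using p(2,3) assms(3) unfolding t by (auto simp: inj_on_def image_iff)
  \<comment> \<open>\<open>f\<close> and \<open>g\<close> list the indices along the cycle: up from
    \<open>i + 1\<close>, where \<open>g\<close> ends with \<open>card A - 1\<close>, the index at
    which \<open>?b\<close> is \<open>v\<close>; then down from \<open>i\<close> for
    \<open>f\<close> and from \<open>i - 1\<close> for \<open>g\<close>; finally \<open>g\<close>
    takes the index \<open>i\<close> skipped so far.\<close>
  define f where "f j = (if j < ?t - 1 - i then i + 1 + j else ?t - 1 - j)" for j
  define g where "g j = (if j < ?t - 1 - i then i + 1 + j else if j < ?t - 1 then ?t - 2 - j else i)" for j
  have f: "bij_betw f {..<?t} {..<?t}"
    using assms(5) by (intro bij_betw_lessThanI) (auto simp: f_def inj_on_def split: if_splits)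
  have g: "bij_betw g {..<?t} {..<?t}"
    using assms(5) by (intro bij_betw_lessThanI) (auto simp: g_def inj_on_def split: if_splits)
  have edge: "R (a j) (?b j)" if "j < ?t" for j
    using p(4)[of j] assms(4) that by (cases "j = ?t - 1") auto
  have edge': "R (a (Suc j)) (?b j)" if "Suc j < ?t" for j
    using p(4)[of j] that by auto
  have "R (a (f j)) (?b (g j)) \<and> R (a (f (Suc j mod ?t))) (?b (g j))" if j: "j < ?t" for j
  proof -
    consider "j < ?t - 1 - i" "Suc j < ?t - 1 - i" | "j < ?t - 1 - i" "\<not> Suc j < ?t - 1 - i"
      | "\<not> j < ?t - 1 - i" "j < ?t - 1" | "j = ?t - 1"
      using j by linarith
    then show ?thesis
    proof cases
      case 1
      then have "f j = i + 1 + j" "f (Suc j mod ?t) = Suc (i + 1 + j)" "g j = i + 1 + j"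
        by (auto simp: f_def g_def)
      then show ?thesis using edge[of "i + 1 + j"] edge'[of "i + 1 + j"] 1 by simp
    next
      case 2
      then have *: "Suc j = ?t - 1 - i" by linarith
      then have "f (Suc j mod ?t) = i" using assms(5) 2 by (auto simp: f_def)
      moreover have "f j = ?t - 1" "g j = ?t - 1" using 2 * by (auto simp: f_def g_def)
      ultimately show ?thesis using assms(4,6) by simp
    next
      case 3
      then have "f j = Suc (?t - 2 - j)" "f (Suc j mod ?t) = ?t - 2 - j" "g j = ?t - 2 - j"
        by (auto simp: f_def g_def)
      then show ?thesis using edge[of "?t - 2 - j"] edge'[of "?t - 2 - j"] 3 by simp
    next
      case 4
      have "f (Suc j mod ?t) = (if i < ?t - 1 then i + 1 else i)" "g j = i" "f j = 0"
        using 4 assms(2,5) by (auto simp: f_def g_def)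
      then show ?thesis using assms(5,7) edge[of i] edge'[of i] by auto
    qed
  qed
  moreover have "(?b \<circ> g) ` {..<?t} \<subseteq> B"
    unfolding image_comp[symmetric] bij_betw_imp_surj_on[OF g] by (rule b(2))
  moreover have "inj_on (?b \<circ> g) {..<?t}"
    using comp_inj_on[of g "{..<?t}" ?b] g b(1) by (simp add: bij_betw_def)
  ultimately have "covering_cycle A B R (a \<circ> f) (?b \<circ> g)"
    unfolding covering_cycle_def o_apply using bij_betw_trans[OF f p(1)] by (simp only: o_def) blast
  then show ?thesis using that by blast
qed

text \<open>The path has only \<open>card A - 1\<close> vertices of \<open>B\<close>, so some vertex
  of \<open>B\<close> lies off it and may serve to close it up.\<close>

lemma covering_cycle_from_path:
  assumes "finite A" "finite B" "card A \<ge> 1" "card A \<le> card B"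
    and degA: "\<And>a. a \<in> A \<Longrightarrow> 2 * card {b\<in>B. R a b} \<ge> card B + 4"
    and degB: "\<And>b. b \<in> B \<Longrightarrow> 2 * card {a\<in>A. R a b} + 2 \<ge> card A"
    and "covering_path A B R a0 b0"
  shows "\<exists>a b. covering_cycle A B R a b"
proof (rule ccontr)
  assume no: "\<nexists>a b. covering_cycle A B R a b"
  let ?t = "card A"
  define N where "N x = {b\<in>B. R x b}" for x
  have finN: "finite (N x)" for x using assms(2) by (simp add: N_def)
  have card_N_B: "card {i\<in>{..<?t}. R (a i) v} = card {x\<in>A. R x v}"
    if "covering_path A B R a b" for a b v
  proof -
    have a: "bij_betw a {..<?t} A" using that by (simp add: covering_path_def)
    have "bij_betw a {i\<in>{..<?t}. R (a i) v} {x\<in>A. R x v}"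
      using a unfolding bij_betw_def by (auto intro: inj_on_subset)
    then show ?thesis by (rule bij_betw_same_card)
  qed
  have card_N_A: "card {i\<in>{..<?t - 1}. R x (b i)} = card (N x \<inter> b ` {..<?t - 1})"
    if "covering_path A B R a b" for a b x
  proof -
    have b: "inj_on b {..<?t - 1}" "b ` {..<?t - 1} \<subseteq> B" using that by (auto simp: covering_path_def)
    have "bij_betw b {i\<in>{..<?t - 1}. R x (b i)} (N x \<inter> b ` {..<?t - 1})"
      using b unfolding bij_betw_def N_def by (auto intro: inj_on_subset)
    then show ?thesis by (rule bij_betw_same_card)
  qed
  \<comment> \<open>The positions \<open>i\<close> with \<open>b i\<close> adjacent to
    \<open>a 0\<close> and those with \<open>a i\<close> adjacent to \<open>v\<close> are disjoint,
    or a crossing closes a cycle. The latter number at least \<open>(t - 2) / 2\<close>. Position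
    \<open>t - 1\<close>, where \<open>v\<close> stands for \<open>b i\<close>, shows that the ends
    have no common neighbour off the path.\<close>
  have crossing_bound: "2 * card (N (a 0) \<inter> b ` {..<?t - 1}) \<le> ?t + 2 \<and> v \<notin> N (a 0)"
    if p: "covering_path A B R a b" and v: "v \<in> B - b ` {..<?t - 1}" "R (a (?t - 1)) v" for a b v
  proof -
    have nocross: "\<not> R (a 0) ((b(?t - 1 := v)) i)" if "i < ?t" "R (a i) v" for i
      using covering_path_crossing[OF p assms(3) v that] no by blast
    let ?X = "{i\<in>{..<?t - 1}. R (a 0) (b i)}" and ?Y = "{i\<in>{..<?t}. R (a i) v}"
    have "?X \<inter> ?Y = {}" using nocross by fastforce
    then have "card ?X + card ?Y = card (?X \<union> ?Y)" by (simp add: card_Un_disjoint)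
    also have "\<dots> \<le> card {..<?t}" by (intro card_mono) auto
    finally have "card (N (a 0) \<inter> b ` {..<?t - 1}) + card {x\<in>A. R x v} \<le> ?t"
      unfolding card_N_B[OF p] card_N_A[OF p] by simp
    moreover have "2 * card {x\<in>A. R x v} + 2 \<ge> ?t" using degB v by blast
    ultimately show ?thesis using nocross[of "?t - 1"] v(2) assms(3) by (auto simp: N_def)
  qed
  have ends_in_A: "a i \<in> A" if "covering_path A B R a b" "i < ?t" for a b i
    using that by (auto simp: covering_path_def bij_betw_def)
  have no_outer_last: "\<not> R (a (?t - 1)) v"
    if p: "covering_path A B R a b" and v: "v \<in> B - b ` {..<?t - 1}" for a b v
  proof
    assume Rv: "R (a (?t - 1)) v"
    let ?P = "b ` {..<?t - 1}"
    have P: "?P \<subseteq> B" "card ?P = ?t - 1"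
      using p by (auto simp: covering_path_def card_image)
    have decomp: "card (N x) = card (N x \<inter> ?P) + card (N x - ?P)" for x
      using card_Un_disjoint[of "N x \<inter> ?P" "N x - ?P"] finN[of x] by (simp add: Int_Diff_Un Int_Diff_disjoint)
    have dd: "2 * card (N (a 0)) \<ge> card B + 4" "2 * card (N (a (?t - 1))) \<ge> card B + 4"
      using degA ends_in_A[OF p] assms(3) by (auto simp: N_def)
    have first: "2 * card (N (a 0) \<inter> ?P) \<le> ?t + 2" using crossing_bound[OF p v Rv] by blast
    \<comment> \<open>As \<open>(t + 2) / 2 < (n + 4) / 2\<close>, the first end also has a
      neighbour off the path, so the same bound holds for the reversed path.\<close>
    then have "card (N (a 0) - ?P) > 0" using decomp[of "a 0"] dd assms(4) by linarith
    then have "N (a 0) - ?P \<noteq> {}" by (metis card.empty less_irrefl)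
    then obtain w where w: "w \<in> B - ?P" "R (a 0) w" by (auto simp: N_def)
    note rev = covering_path_reverse[OF p]
    have last: "2 * card (N (a (?t - 1)) \<inter> ?P) \<le> ?t + 2"
      using crossing_bound[OF rev, unfolded covering_path_reverse_image, of w] w by simp
    have "N (a 0) \<inter> N (a (?t - 1)) - ?P = {}"
      using crossing_bound[OF p] by (auto simp: N_def)
    then have "card (N (a 0) - ?P) + card (N (a (?t - 1)) - ?P) =
        card ((N (a 0) - ?P) \<union> (N (a (?t - 1)) - ?P))"
      using finN by (subst card_Un_disjoint) auto
    also have "\<dots> \<le> card (B - ?P)" using assms(2) by (intro card_mono) (auto simp: N_def)
    also have "\<dots> = card B - (?t - 1)" using P assms(2) by (simp add: card_Diff_subset finite_subset)
    \<comment> \<open>The degrees of the two ends add up to at least \<open>card B + 4\<close>, but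
      to at most \<open>t + 2\<close> on the path and \<open>card B - (t - 1)\<close> off
      it.\<close>
    finally show False using first last dd decomp[of "a 0"] decomp[of "a (?t - 1)"] assms(3,4)
      by linarith
  qed
  have no_outer_first: "\<not> R (a 0) v"
    if p: "covering_path A B R a b" and v: "v \<in> B - b ` {..<?t - 1}" for a b v
    using no_outer_last[OF covering_path_reverse[OF p], unfolded covering_path_reverse_image, OF v]
    by simp
  note p = assms(7)
  let ?P = "b0 ` {..<?t - 1}"
  have "card ?P < card B" using card_image_le[of "{..<?t - 1}" b0] assms(3,4) by simp
  then have "\<not> B \<subseteq> ?P" using card_mono[of ?P B] by auto
  then obtain v where v: "v \<in> B - ?P" by blast
  have "N (a0 0) \<inter> ?P = N (a0 0)" using no_outer_first[OF p] by (auto simp: N_def)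
  then have X: "2 * card {i\<in>{..<?t - 1}. R (a0 0) (b0 i)} \<ge> card B + 4"
    using degA[of "a0 0"] ends_in_A[OF p, of 0] assms(3) unfolding card_N_A[OF p] by (simp add: N_def)
  have Y: "2 * card {i\<in>{..<?t}. R (a0 i) v} + 2 \<ge> ?t"
    using degB[of v] v unfolding card_N_B[OF p] by blast
  \<comment> \<open>Twice the sizes add up to at least \<open>card B + 4 + t - 2 > 2 * t\<close>,
    too much for disjoint sets of positions.\<close>
  have "{i\<in>{..<?t - 1}. R (a0 0) (b0 i)} \<inter> {i\<in>{..<?t}. R (a0 i) v} \<noteq> {}" (is "?X \<inter> ?Y \<noteq> {}")
  proof
    assume "?X \<inter> ?Y = {}"
    then have "card ?X + card ?Y = card (?X \<union> ?Y)" by (simp add: card_Un_disjoint)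
    also have "\<dots> \<le> card {..<?t}" by (intro card_mono) auto
    finally show False using X Y assms(4) by simp
  qed
  then obtain i where i: "i < ?t - 1" "R (a0 0) (b0 i)" "R (a0 i) v" by auto
  \<comment> \<open>Rotation makes \<open>a0 i\<close> an end while \<open>v\<close>, its neighbour,
    stays off the path.\<close>
  from covering_path_rotate[OF p i(1,2)] obtain a' b' where
    "covering_path A B R a' b'" "a' 0 = a0 i" "b' ` {..<?t - 1} = ?P" by blast
  then show False using no_outer_first[of a' b' v] i(3) v by simp
qed

text \<open>Start reading just after \<open>b s\<close>: the shift by \<open>Suc s\<close> moves
  \<open>b s\<close> to position \<open>card A - 1\<close>, which a path does not use.\<close>

lemma covering_path_from_cycle:
  assumes cyc: "covering_cycle A B R a b" and s: "s < card A"
  shows "covering_path A (B - {b s}) R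
    (\<lambda>j. a ((Suc s + j) mod card A)) (\<lambda>j. b ((Suc s + j) mod card A))"
proof -
  let ?t = "card A" and ?f = "\<lambda>j. (Suc s + j) mod card A"
  have c: "bij_betw a {..<?t} A" "inj_on b {..<?t}" "b ` {..<?t} \<subseteq> B"
    "\<And>i. i < ?t \<Longrightarrow> R (a i) (b i) \<and> R (a (Suc i mod ?t)) (b i)"
    using cyc by (auto simp: covering_cycle_def)
  have f: "bij_betw ?f {..<?t} {..<?t}" by (rule bij_betw_add_mod)
  have flt: "?f j < ?t" for j using s by simp
  have last: "?f (?t - 1) = s" using s by (simp add: algebra_simps)
  have neq: "?f j \<noteq> s" if "j < ?t - 1" for j
    using inj_onD[OF bij_betw_imp_inj_on[OF f], of j "?t - 1"] that s unfolding last by fastforce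
  have binj: "inj_on (\<lambda>j. b (?f j)) {..<?t}"
    using comp_inj_on[of ?f "{..<?t}" b] f c(2) by (simp add: bij_betw_def o_def)
  have "bij_betw (\<lambda>j. a (?f j)) {..<?t} A" using bij_betw_trans[OF f c(1)] by (simp add: o_def)
  moreover have "inj_on (\<lambda>j. b (?f j)) {..<?t - 1}" using binj by (rule inj_on_subset) auto
  moreover have "b (?f j) \<in> B - {b s}" if "j < ?t - 1" for j
    using c(2,3) flt[of j] neq[OF that] s by (auto simp: inj_on_def)
  moreover have "R (a (?f j)) (b (?f j)) \<and> R (a (?f (Suc j))) (b (?f j))" for j
    using c(4)[OF flt[of j]] by (simp add: mod_Suc_eq)
  ultimately show ?thesis unfolding covering_path_def by (simp add: image_subset_iff)
qed

text \<open>The relations are compared on the smaller \<open>B\<close> only, so the artificial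
  adjacencies of a vertex missing from it can be discarded.\<close>

lemma covering_path_mono:
  assumes "covering_path A B R a b" "B \<subseteq> B'" "\<And>x y. x \<in> A \<Longrightarrow> y \<in> B \<Longrightarrow> R x y \<Longrightarrow> R' x y"
  shows "covering_path A B' R' a b"
proof -
  have p: "bij_betw a {..<card A} A" "inj_on b {..<card A - 1}" "b ` {..<card A - 1} \<subseteq> B"
    "\<And>i. i < card A - 1 \<Longrightarrow> R (a i) (b i) \<and> R (a (Suc i)) (b i)"
    using assms(1) by (auto simp: covering_path_def)
  have "R' (a i) (b i) \<and> R' (a (Suc i)) (b i)" if "i < card A - 1" for i
  proof -
    have "a i \<in> A" "a (Suc i) \<in> A" using that bij_betw_apply[OF p(1)] by auto
    moreover have "b i \<in> B" using that p(3) by auto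
    ultimately show ?thesis using p(4)[OF that] assms(3) by simp
  qed
  then show ?thesis using p(1-3) assms(2) by (auto simp: covering_path_def)
qed

text \<open>Joining the vertices of \<open>B\<close> to all of \<open>A\<close>, one after the other, leads to a complete bipartite
  graph. Going back, a cycle through the last joined vertex yields a path avoiding that vertex.\<close>

theorem bipartite_covering_cycle:
  assumes "finite A" "finite B" "card A \<ge> 1" "card A \<le> card B"
    and degA: "\<And>a. a \<in> A \<Longrightarrow> 2 * card {b\<in>B. R a b} \<ge> card B + 4"
    and degB: "\<And>b. b \<in> B \<Longrightarrow> 2 * card {a\<in>A. R a b} + 2 \<ge> card A"
  shows "\<exists>a b. covering_cycle A B R a b"
proof -
  let ?t = "card A"
  have "(\<exists>a b. covering_cycle A B (\<lambda>x y. R x y \<or> y \<in> D) a b) \<Longrightarrow> \<exists>a b. covering_cycle A B R a b"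
    if "D \<subseteq> B" for D
    using finite_subset[OF that assms(2)] that
  proof (induction D rule: finite_induct)
    case (insert d D)
    let ?R = "\<lambda>x y. R x y \<or> y \<in> D"
    from insert.prems obtain a b where cyc: "covering_cycle A B (\<lambda>x y. R x y \<or> y \<in> insert d D) a b"
      by blast
    have "\<exists>a b. covering_cycle A B ?R a b"
    proof (cases "\<exists>s<?t. b s = d")
      case False
      then have "covering_cycle A B ?R a b" using cyc by (auto simp: covering_cycle_def)
      then show ?thesis by blast
    next
      case True
      then obtain s where s: "s < ?t" "b s = d" by blast
      from covering_path_from_cycle[OF cyc s(1)] obtain a' b' where
        "covering_path A (B - {d}) (\<lambda>x y. R x y \<or> y \<in> insert d D) a' b'" unfolding s by blast
      \<comment> \<open>The path avoids \<open>d\<close>, so it needs none of the adjacencies added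
        for \<open>d\<close>. The degree conditions persist because \<open>?R\<close> contains
        \<open>R\<close>.\<close>
      then have p: "covering_path A B ?R a' b'" by (rule covering_path_mono) auto
      have "2 * card {b\<in>B. ?R x b} \<ge> card B + 4" if "x \<in> A" for x
      proof -
        have "card {b\<in>B. R x b} \<le> card {b\<in>B. ?R x b}" using assms(2) by (intro card_mono) auto
        then show ?thesis using degA[OF that] by linarith
      qed
      moreover have "2 * card {x\<in>A. ?R x y} + 2 \<ge> ?t" if "y \<in> B" for y
      proof -
        have "card {x\<in>A. R x y} \<le> card {x\<in>A. ?R x y}" using assms(1) by (intro card_mono) auto
        then show ?thesis using degB[OF that] by linarith
      qed
      ultimately show ?thesis by (rule covering_cycle_from_path[OF assms(1-4) _ _ p])
    qed
    then show ?case using insert by auto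
  qed simp
  moreover have "\<exists>a b. covering_cycle A B (\<lambda>x y. R x y \<or> y \<in> B) a b"
  proof -
    obtain a where a: "bij_betw a {..<?t} A"
      using ex_bij_betw_nat_finite[OF assms(1)] by (auto simp: atLeast0LessThan)
    obtain b where b: "bij_betw b {..<card B} B"
      using ex_bij_betw_nat_finite[OF assms(2)] by (auto simp: atLeast0LessThan)
    have "{..<?t} \<subseteq> {..<card B}" using assms(4) by auto
    then have "inj_on b {..<?t}" "b ` {..<?t} \<subseteq> B" using b unfolding bij_betw_def
      by (auto intro: inj_on_subset)
    then show ?thesis using a by (intro exI[of _ a] exI[of _ b]) (auto simp: covering_cycle_def)
  qed
  ultimately show ?thesis by blast
qed

section \<open>Almost regular hypergraphs with large edges\<close>

text \<open>Indices shift by one: \<open>b i\<close> and its successor both lie in the successor of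
  \<open>a i\<close>, so this edge takes position \<open>i\<close> in the Berge cycle.\<close>

lemma is_cycle_if_covering_cycle:
  assumes "covering_cycle (edges H) (verts H) (\<lambda>e v. v \<in> ends H e) a b" "card (edges H) \<ge> 2"
  shows "is_cycle H (card (edges H))"
proof -
  let ?t = "card (edges H)"
  have c: "bij_betw a {..<?t} (edges H)" "inj_on b {..<?t}" "b ` {..<?t} \<subseteq> verts H"
    "\<And>i. i < ?t \<Longrightarrow> b i \<in> ends H (a i) \<and> b i \<in> ends H (a (Suc i mod ?t))"
    using assms(1) by (auto simp: covering_cycle_def)
  have "bij_betw (\<lambda>i. a (Suc i mod ?t)) {..<?t} (edges H)"
    using bij_betw_trans[OF bij_betw_add_mod[of 1 ?t] c(1)] by (simp add: o_def)
  moreover have "{b i, b (Suc i mod ?t)} \<subseteq> ends H (a (Suc i mod ?t))" if "i < ?t" for i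
    using c(4)[OF that] c(4)[of "Suc i mod ?t"] assms(2) by simp
  ultimately show ?thesis
    unfolding is_cycle_def using c(2,3) assms(2)
    by (intro conjI exI[of _ b] exI[of _ "\<lambda>i. a (Suc i mod ?t)"]) (auto simp: bij_betw_def)
qed

lemma card_edges_cycle: "is_cycle H t \<Longrightarrow> finite (edges H) \<and> card (edges H) = t"
  by (auto simp: is_cycle_def card_image)

text \<open>The bipartite theorem for the incidence relation. Almost regularity enters through the
  lower bound on the degrees.\<close>

lemma almost_regular_is_cycle:
  assumes "finite (verts H)" "finite (edges H)" "2 \<le> card (edges H)" "card (edges H) \<le> card (verts H)"
    and "\<And>e. e \<in> edges H \<Longrightarrow> ends H e \<subseteq> verts H \<and> card (verts H) + 4 \<le> 2 * card (ends H e)"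
    and "\<And>v. v \<in> verts H \<Longrightarrow> card (edges H) \<le> 2 * degree H v + 2"
  shows "is_cycle H (card (edges H))"
proof -
  have "\<exists>a b. covering_cycle (edges H) (verts H) (\<lambda>e v. v \<in> ends H e) a b"
  proof (rule bipartite_covering_cycle[OF assms(2,1) _ assms(4)])
    show "card (verts H) + 4 \<le> 2 * card {v \<in> verts H. v \<in> ends H e}" if "e \<in> edges H" for e
    proof -
      have "{v \<in> verts H. v \<in> ends H e} = ends H e" using assms(5)[OF that] by blast
      then show ?thesis using assms(5)[OF that] by simp
    qed
    show "card (edges H) \<le> 2 * card {e \<in> edges H. v \<in> ends H e} + 2" if "v \<in> verts H" for v
      using assms(6)[OF that] unfolding degree_def .
  qed (use assms(3) in simp_all)
  then show ?thesis using is_cycle_if_covering_cycle assms(3) by blast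
qed

theorem corollary2p6:
  fixes c :: "nat \<Rightarrow> nat" and k n h m :: nat and V :: "'v set"
  assumes "k \<ge> 1" and "n \<ge> 1" and "h \<ge> 1" and "m \<ge> 1"
    and "finite V" and "card V = n"
    and "2 \<le> c 1" and "mono_on {1..k} c" and "c k \<le> n"
    and "real h \<ge> real n / 2 + 2"
  shows "decomposes_into_ar_spanning_cycles (complete_hypergraph m h V) k c
           \<longleftrightarrow> (\<Sum>i=1..k. c i) = m * (n choose h)"
proof
  let ?H = "complete_hypergraph m h V"
  assume "decomposes_into_ar_spanning_cycles ?H k c"
  then obtain P where P: "(\<Union>i\<in>{1..k}. P i) = edges ?H" "disjoint_family_on P {1..k}"
    "\<And>i. i \<in> {1..k} \<Longrightarrow> is_cycle (?H\<lparr>edges := P i\<rparr>) (c i)"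
    unfolding decomposes_into_ar_spanning_cycles_def decomposition_def by blast
  have Pc: "finite (P i)" "card (P i) = c i" if "i \<in> {1..k}" for i
    using card_edges_cycle[OF P(3)[OF that]] by auto
  have "(\<Sum>i=1..k. c i) = card (\<Union>i\<in>{1..k}. P i)"
    using P(2) Pc by (subst card_UN_disjoint) (auto simp: disjoint_family_on_def)
  also have "\<dots> = (n choose h) * m"
    unfolding P(1) using assms(5,6)
    by (simp add: complete_hypergraph_def card_cartesian_product n_subsets)
  finally show "(\<Sum>i=1..k. c i) = m * (n choose h)" by simp
next
  let ?H = "complete_hypergraph m h V"
  assume total: "(\<Sum>i=1..k. c i) = m * (n choose h)"
  have h: "2 * h \<ge> n + 4" using assms(10) by linarith
  have c: "2 \<le> c i" "c i \<le> n" if "i \<in> {1..k}" for i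
  proof -
    have "c 1 \<le> c i" "c i \<le> c k" using that assms(8) by (auto simp: mono_on_def)
    then show "2 \<le> c i" "c i \<le> n" using assms(7,9) by auto
  qed
  \<comment> \<open>The average degree of a class of \<open>c i\<close> edges of size
    \<open>h\<close>, rounded down.\<close>
  define q where "q i = c i * h div n" for i
  have q: "q i * n \<le> c i * h" "c i * h < (q i + 1) * n" for i
    using assms(2) dividend_less_div_times[of n "c i * h"] by (simp_all add: q_def algebra_simps)
  then have "\<exists>P :: nat \<Rightarrow> ('v set \<times> nat) set.
      (\<Union>i\<in>{1..k}. P i) = {S. S \<subseteq> V \<and> card S = h} \<times> {..<m} \<and> disjoint_family_on P {1..k} \<and>
      (\<forall>i\<in>{1..k}. card (P i) = c i \<and> (\<forall>v\<in>V. card {e \<in> P i. v \<in> fst e} \<in> {q i, q i + 1}))"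
    using assms(5,6) total by (intro baranyai) (auto simp: less_imp_le)
  then obtain P :: "nat \<Rightarrow> ('v set \<times> nat) set" where
    P: "(\<Union>i\<in>{1..k}. P i) = {S. S \<subseteq> V \<and> card S = h} \<times> {..<m}" "disjoint_family_on P {1..k}"
    and P': "\<forall>i\<in>{1..k}. card (P i) = c i \<and>
      (\<forall>v\<in>V. card {e \<in> P i. v \<in> fst e} \<in> {q i, q i + 1})"
    by (elim exE conjE)
  note Pc = P'[rule_format, THEN conjunct1]
    and deg = P'[rule_format, THEN conjunct2, rule_format]
  have "is_cycle (?H\<lparr>edges := P i\<rparr>) (c i) \<and> spanning (?H\<lparr>edges := P i\<rparr>) \<and>
      almost_regular (?H\<lparr>edges := P i\<rparr>)" if i: "i \<in> {1..k}" for i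
  proof -
    let ?Hi = "?H\<lparr>edges := P i\<rparr>"
    have Hi: "verts ?Hi = V" "edges ?Hi = P i" "ends ?Hi = fst"
      by (simp_all add: complete_hypergraph_def)
    have di: "degree ?Hi v \<in> {q i, q i + 1}" if "v \<in> V" for v
      using deg[OF i that] by (simp add: degree_def Hi)
    have edge: "fst e \<subseteq> V" "card (fst e) = h" if "e \<in> P i" for e
    proof -
      have "e \<in> (\<Union>i\<in>{1..k}. P i)" using i that by blast
      then show "fst e \<subseteq> V" "card (fst e) = h" unfolding P(1) by auto
    qed
    \<comment> \<open>Edges have more than half of the vertices, so the average degree is at least
      \<open>c i / 2\<close> and rounding down loses less than 1.\<close>
    have "c i * n < 2 * (q i + 1) * n"
    proof -
      have "c i * n \<le> c i * (2 * h)" using h by (intro mult_left_mono) auto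
      also have "\<dots> < 2 * ((q i + 1) * n)" using q(2)[of i] by simp
      finally show ?thesis by simp
    qed
    then have "c i < 2 * (q i + 1)" by (metis mult_less_cancel2)
    then have qc: "c i \<le> 2 * q i + 2" by simp
    \<comment> \<open>Two edges already have total size at least \<open>n\<close>, so all degrees
      are positive and the class is spanning.\<close>
    have "n \<le> 2 * h" using h by simp
    also have "\<dots> \<le> c i * h" using c(1)[OF i] by (intro mult_right_mono) auto
    finally have q1: "q i \<ge> 1" using assms(2) by (simp add: q_def div_greater_zero_iff Suc_le_eq)
    have "card (P i) \<ge> 2" using Pc c i by simp
    then have fin: "finite (P i)" by (intro card_ge_0_finite) simp
    have "is_cycle ?Hi (card (edges ?Hi))"
    proof (rule almost_regular_is_cycle)
      show "ends ?Hi e \<subseteq> verts ?Hi \<and> card (verts ?Hi) + 4 \<le> 2 * card (ends ?Hi e)"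
        if "e \<in> edges ?Hi" for e
        using that edge[of e] assms(6) h unfolding Hi by simp
      show "card (edges ?Hi) \<le> 2 * degree ?Hi v + 2" if "v \<in> verts ?Hi" for v
        using that di[of v] qc Pc[OF i] unfolding Hi by auto
    qed (use assms(5,6) c[OF i] Pc[OF i] fin in \<open>simp_all add: Hi\<close>)
    moreover have "spanning ?Hi"
      unfolding spanning_def
    proof
      fix v assume "v \<in> verts ?Hi"
      then have "degree ?Hi v \<noteq> 0" using di[of v] q1 by (auto simp: Hi)
      then have "{e \<in> edges ?Hi. v \<in> ends ?Hi e} \<noteq> {}" unfolding degree_def by (metis card.empty)
      then show "\<exists>e\<in>edges ?Hi. v \<in> ends ?Hi e" by blast
    qed
    moreover have "almost_regular ?Hi" unfolding almost_regular_def Hi using di by auto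
    ultimately show ?thesis by (simp add: Hi Pc[OF i])
  qed
  moreover have "P i \<noteq> {}" if "i \<in> {1..k}" for i
    using Pc[OF that] c(1)[OF that] by auto
  then have "decomposition ?H {1..k} P"
    unfolding decomposition_def using P by (simp add: complete_hypergraph_def)
  ultimately show "decomposes_into_ar_spanning_cycles ?H k c"
    unfolding decomposes_into_ar_spanning_cycles_def by blast
qed

end
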